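(* Let $(T_1,\dots,T_k)$ be a doubly commuting $k$-tuple of near-isometries on a Hilbert space $\mathcal{H}$. Then for any integer $m$ with $2\le m\le k$, there exist $2^m$ joint $(T_1,\dots,T_m)$-reducing subspaces $\{\mathcal{H}_A: A\subseteq I_m\}$ such that $$\mathcal{H}=\bigoplus_{A\subseteq I_m}\mathcal{H}_A,$$ where for a non-empty $A\subseteq I_m$, $$\mathcal{H}_A=\bigoplus_{\boldsymbol{r}\in\mathbb{N}_0^A}T_A^{\boldsymbol{r}}\Big(\bigcap_{\boldsymbol{j}\in\mathbb{N}_0^{I_m\setminus A}}T_{I_m\setminus A}^{\boldsymbol{j}}\mathcal{W}_A\Big),$$ and for $A=\emptyset$, $$\mathcal{H}_A=\bigcap_{\boldsymbol{r}\in\mathbb{N}_0^{I_m}}T_{I_m}^{\boldsymbol{r}}\mathcal{H}.$$ Furthermore, for each $A\subseteq I_m$, $T_i|_{\mathcal{H}_A}$ is a shift if $i\in A$ and is invertible if $i\in I_m\setminus A$.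
   Context: An operator $T\in B(\mathcal{H})$ on a Hilbert space $\mathcal{H}$ is a near-isometry if (i) there is a constant $\delta>0$ such that $\delta\|x\|\le\|Tx\|\le\|x\|$ for all $x\in\mathcal{H}$, and (ii) for each $k\ge1$, $T^{*k}T^{k+1}\mathcal{H}\subseteq T\mathcal{H}$. A $k$-tuple $(T_1,\dots,T_k)$ of commuting operators on $\mathcal{H}$ is doubly commuting if $T_iT_j^*=T_j^*T_i$ whenever $i\ne j$. A subspace is joint $(T_1,\dots,T_m)$-reducing if it reduces each $T_i$, $1\le i\le m$. Notation: $\mathbb{N}_0=\mathbb{N}\cup\{0\}$; $I_m=\{1,\dots,m\}$. For $A=\{i_1,\dots,i_l\}\subseteq I_m$, $\mathbb{N}_0^A=\mathbb{N}_0\times\cdots\times\mathbb{N}_0$ ($|A|$ copies), and for $\boldsymbol{r}=(r_{i_1},\dots,r_{i_l})\in\mathbb{N}_0^A$, $T_A^{\boldsymbol{r}}=T_{i_1}^{r_{i_1}}\cdots T_{i_l}^{r_{i_l}}$ (the identity when $A=\emptyset$). Further $\mathcal{W}_i=\mathcal{H}\ominus T_i\mathcal{H}=\ker(T_i^* )$, $\mathcal{W}_A=\bigcap_{i\in A}\mathcal{W}_i$, and $\mathcal{W}_\emptyset=\mathcal{H}$. A closed subspace $\mathcal{W}$ of a Hilbert space $\mathcal{K}$ is wandering for $T\in B(\mathcal{K})$ if $T^k\mathcal{W}\perp T^l\mathcal{W}$ whenever $k\ne l$. An operator $T\in B(\mathcal{K})$ is a shift on $\mathcal{K}$ if there is a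 wandering subspace $\mathcal{W}$ of $T$ with $\mathcal{K}=\bigoplus_{k=0}^\infty T^k\mathcal{W}$. All direct sums are orthogonal Hilbert space direct sums. *)

theory Defs
  imports "HOL-Analysis.Analysis"
begin

text \<open>
  Complex Hilbert spaces. The norm and topology are those of the underlying real Hilbert space,
  whose inner product is the real part of the complex one; hence the norm of x is the square root
  of \<open>cinner x x\<close>, and positive definiteness is inherited from \<^class>\<open>real_inner\<close>.
  The complex inner product is linear in its first argument.
\<close>

class complex_hilbert = real_inner + complete_space +
  fixes scaleC :: "complex \<Rightarrow> 'a \<Rightarrow> 'a"  (infixr "*\<^sub>C" 75)
    and cinner :: "'a \<Rightarrow> 'a \<Rightarrow> complex"
  assumes scaleC_add_right: "c *\<^sub>C (x + y) = c *\<^sub>C x + c *\<^sub>C y"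
    and scaleC_add_left: "(c + d) *\<^sub>C x = c *\<^sub>C x + d *\<^sub>C x"
    and scaleC_scaleC: "c *\<^sub>C d *\<^sub>C x = (c * d) *\<^sub>C x"
    and scaleR_eq_scaleC: "r *\<^sub>R x = complex_of_real r *\<^sub>C x"
    and cinner_commute: "cinner x y = cnj (cinner y x)"
    and cinner_add_left: "cinner (x + y) z = cinner x z + cinner y z"
    and cinner_scaleC_left: "cinner (c *\<^sub>C x) y = c * cinner x y"
    and inner_eq_Re_cinner: "inner x y = Re (cinner x y)"

instantiation complex :: complex_hilbert
begin

definition scaleC_complex :: "complex \<Rightarrow> complex \<Rightarrow> complex"
  where "scaleC_complex c x = c * x"

definition cinner_complex :: "complex \<Rightarrow> complex \<Rightarrow> complex"
  where "cinner_complex x y = x * cnj y"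

instance
  by standard
    (simp_all add: scaleC_complex_def cinner_complex_def algebra_simps scaleR_conv_of_real
      inner_complex_def)

end


definition csubspace :: "'a::complex_hilbert set \<Rightarrow> bool"
  where "csubspace M \<longleftrightarrow>
    0 \<in> M \<and> (\<forall>x\<in>M. \<forall>y\<in>M. x + y \<in> M) \<and> (\<forall>c. \<forall>x\<in>M. c *\<^sub>C x \<in> M)"

definition closed_csubspace :: "'a::complex_hilbert set \<Rightarrow> bool"
  where "closed_csubspace M \<longleftrightarrow> csubspace M \<and> closed M"

definition orthogonal_sets :: "'a::complex_hilbert set \<Rightarrow> 'a set \<Rightarrow> bool"
  where "orthogonal_sets M N \<longleftrightarrow> (\<forall>x\<in>M. \<forall>y\<in>N. cinner x y = 0)"

definition ortho_complement :: "'a::complex_hilbert set \<Rightarrow> 'a set"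
  where "ortho_complement M = {x. \<forall>y\<in>M. cinner x y = 0}"

text \<open>
  \<open>orth_direct_sum I M K\<close>: K is the (internal) Hilbert space direct sum of the pairwise orthogonal
  closed subspaces \<open>M i\<close>, \<open>i \<in> I\<close>, that is, the closure of their linear span.
\<close>

definition orth_direct_sum :: "'i set \<Rightarrow> ('i \<Rightarrow> 'a::complex_hilbert set) \<Rightarrow> 'a set \<Rightarrow> bool"
  where "orth_direct_sum I M K \<longleftrightarrow>
    (\<forall>i\<in>I. closed_csubspace (M i)) \<and>
    (\<forall>i\<in>I. \<forall>j\<in>I. i \<noteq> j \<longrightarrow> orthogonal_sets (M i) (M j)) \<and>
    K = closure (csubspace hull (\<Union>i\<in>I. M i))"

text \<open>
  \<open>bounded_op_on K T\<close> says that the restriction of T to the subspace K belongs to \<open>B(K)\<close>;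
  the values of T outside K are irrelevant.
\<close>

definition bounded_op_on :: "'a::complex_hilbert set \<Rightarrow> ('a \<Rightarrow> 'a) \<Rightarrow> bool"
  where "bounded_op_on K T \<longleftrightarrow>
    T ` K \<subseteq> K \<and>
    (\<forall>x\<in>K. \<forall>y\<in>K. T (x + y) = T x + T y) \<and>
    (\<forall>c. \<forall>x\<in>K. T (c *\<^sub>C x) = c *\<^sub>C T x) \<and>
    (\<exists>B. \<forall>x\<in>K. norm (T x) \<le> B * norm x)"

definition cadjoint :: "('a::complex_hilbert \<Rightarrow> 'a) \<Rightarrow> 'a \<Rightarrow> 'a"
  where "cadjoint T = (THE S. \<forall>x y. cinner (T x) y = cinner x (S y))"

definition near_isometry :: "('a::complex_hilbert \<Rightarrow> 'a) \<Rightarrow> bool"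
  where "near_isometry T \<longleftrightarrow>
    bounded_op_on UNIV T \<and>
    (\<exists>\<delta>>0. \<forall>x. \<delta> * norm x \<le> norm (T x) \<and> norm (T x) \<le> norm x) \<and>
    (\<forall>k\<ge>1. range ((cadjoint T ^^ k) \<circ> (T ^^ (k + 1))) \<subseteq> range T)"

definition doubly_commuting :: "nat \<Rightarrow> (nat \<Rightarrow> 'a::complex_hilbert \<Rightarrow> 'a) \<Rightarrow> bool"
  where "doubly_commuting k T \<longleftrightarrow>
    (\<forall>i\<in>{1..k}. \<forall>j\<in>{1..k}. T i \<circ> T j = T j \<circ> T i) \<and>
    (\<forall>i\<in>{1..k}. \<forall>j\<in>{1..k}. i \<noteq> j \<longrightarrow> T i \<circ> cadjoint (T j) = cadjoint (T j) \<circ> T i)"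

definition reduces :: "'a::complex_hilbert set \<Rightarrow> ('a \<Rightarrow> 'a) \<Rightarrow> bool"
  where "reduces M T \<longleftrightarrow>
    closed_csubspace M \<and> T ` M \<subseteq> M \<and> T ` ortho_complement M \<subseteq> ortho_complement M"

text \<open>
  For \<open>A = {i\<^sub>1 < \<dots> < i\<^sub>l}\<close> this is the composition of the powers \<open>T i ^^ r i\<close>, taken
  in the order \<open>i\<^sub>1, \<dots>, i\<^sub>l\<close> from left to right. Multi-indices over A are the extensional
  functions \<open>A \<rightarrow>\<^sub>E UNIV\<close>, of which there is exactly one when A is empty.
\<close>

definition multi_power :: "(nat \<Rightarrow> 'a \<Rightarrow> 'a) \<Rightarrow> nat set \<Rightarrow> (nat \<Rightarrow> nat) \<Rightarrow> 'a \<Rightarrow> 'a"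
  where "multi_power T A r = foldr (\<lambda>i f. (T i ^^ r i) \<circ> f) (sorted_list_of_set A) id"

definition multi_indices :: "nat set \<Rightarrow> (nat \<Rightarrow> nat) set"
  where "multi_indices A = A \<rightarrow>\<^sub>E UNIV"

definition defect_space :: "(nat \<Rightarrow> 'a::complex_hilbert \<Rightarrow> 'a) \<Rightarrow> nat set \<Rightarrow> 'a set"
  where "defect_space T A = (\<Inter>i\<in>A. ortho_complement (range (T i)))"

definition wandering_on :: "'a::complex_hilbert set \<Rightarrow> ('a \<Rightarrow> 'a) \<Rightarrow> 'a set \<Rightarrow> bool"
  where "wandering_on K T W \<longleftrightarrow>
    closed_csubspace W \<and> W \<subseteq> K \<and>
    (\<forall>k l. k \<noteq> l \<longrightarrow> orthogonal_sets ((T ^^ k) ` W) ((T ^^ l) ` W))"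

definition shift_on :: "'a::complex_hilbert set \<Rightarrow> ('a \<Rightarrow> 'a) \<Rightarrow> bool"
  where "shift_on K T \<longleftrightarrow>
    bounded_op_on K T \<and>
    (\<exists>W. wandering_on K T W \<and> orth_direct_sum (UNIV :: nat set) (\<lambda>k. (T ^^ k) ` W) K)"

definition invertible_on :: "'a::complex_hilbert set \<Rightarrow> ('a \<Rightarrow> 'a) \<Rightarrow> bool"
  where "invertible_on K T \<longleftrightarrow>
    bounded_op_on K T \<and>
    (\<exists>S. bounded_op_on K S \<and> (\<forall>x\<in>K. S (T x) = x \<and> T (S x) = x))"

end

theory Submission
  imports Defs
begin

text \<open>
  For a single near-isometry T put \<open>defect T = ker T\<^sup>*\<close>, the complement of the range of T, and
  \<open>invertible_part T = (\<Inter>n. range (T ^^ n))\<close>. The range condition in the definition of a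
  near-isometry replaces the identity \<open>T\<^sup>* T = 1\<close> in the classical Wold decomposition: it makes
  \<open>T\<^sup>n w\<close> orthogonal to the range of \<open>T\<^sup>n\<^sup>+\<^sup>1\<close> for w in the defect space. Hence the images
  \<open>T\<^sup>n (defect T)\<close> are pairwise orthogonal, the range of \<open>T\<^sup>n\<close> is the orthogonal complement of the
  first n of them (\<open>range_funpow_eq\<close>), and the invertible part is the complement of all of them. Its
  own complement \<open>shift_part T\<close> is therefore their closed span, and both parts reduce T.

  The projection onto a subspace N that reduces T commutes with T and with its adjoint. Three facts
  about N result. If N lies in the shift part, it is spanned by the images of \<open>N \<inter> defect T\<close> under the
  powers of T, so T is a shift on N (\<open>reducing_subset_shift_part\<close>, \<open>shift_on_reducing\<close>). If N
  lies in the invertible part, T maps N onto itself and is invertible there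
  (\<open>invertible_on_reducing\<close>). In general N is the sum of its intersections with the two parts
  (\<open>wold_decomposition\<close>).

  For a doubly commuting tuple, the defect space, the invertible part and the shift part of one
  operator reduce all the other operators. The summand for an index set A is
  the intersection of the shift parts for the indices in A and the invertible parts for the others
  (\<open>wold_part\<close>). Two such summands are orthogonal because some index separates them, and splitting
  one operator at a time shows that together they span the space (\<open>orth_direct_sum_wold_parts\<close>).
  The inner formula for a summand follows by applying the statement on the shift part to one operator
  of A after another; each step replaces N by \<open>N \<inter> defect (T a)\<close>, which still reduces the remaining
  operators (\<open>reducing_eq_monomial_span\<close>). What is left after the last step is the part of the joint
  defect space that lies in the invertible parts of the other operators, and this part is the
  intersection of images that the theorem names (\<open>wandering_part_eq\<close>).
\<close>

section \<open>Orthogonality and closed spans\<close>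

lemma scaleC_simps [simp]:
  fixes x :: "'a::complex_hilbert"
  shows "1 *\<^sub>C x = x" "0 *\<^sub>C x = 0" "c *\<^sub>C (0::'a) = 0" "(-1) *\<^sub>C x = - x"
proof -
  show "1 *\<^sub>C x = x" "0 *\<^sub>C x = 0" "(-1) *\<^sub>C x = - x"
    using scaleR_eq_scaleC[of 1 x] scaleR_eq_scaleC[of 0 x] scaleR_eq_scaleC[of "-1" x] by auto
  have "c *\<^sub>C 0 *\<^sub>R (0::'a) = (c * 0) *\<^sub>C 0"
    by (metis scaleR_eq_scaleC scaleC_scaleC of_real_0)
  then show "c *\<^sub>C (0::'a) = 0" using scaleR_eq_scaleC[of 0 "0::'a"] by simp
qed

lemma cinner_scaleC_right: "cinner x (c *\<^sub>C y) = cnj c * cinner x y"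
  by (metis cinner_commute cinner_scaleC_left complex_cnj_mult)

lemma cinner_add_right: "cinner x (y + z) = cinner x y + cinner x z"
  by (metis cinner_commute cinner_add_left complex_cnj_add)

lemma cinner_minus_left: "cinner (- x) y = - cinner x y"
  using cinner_scaleC_left[of "-1" x y] by simp

lemma cinner_minus_right: "cinner x (- y) = - cinner x y"
  using cinner_scaleC_right[of x "-1" y] by simp

lemma cinner_diff_left: "cinner (x - y) z = cinner x z - cinner y z"
  using cinner_add_left[of x "- y" z] by (simp add: cinner_minus_left)

lemma cinner_diff_right: "cinner x (y - z) = cinner x y - cinner x z"
  using cinner_add_right[of x y "- z"] by (simp add: cinner_minus_right)

lemma cinner_zero [simp]: "cinner 0 x = 0" "cinner x 0 = 0"
  using cinner_diff_left[of x x x] cinner_diff_right[of x x x] by simp_all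

lemma cinner_self: "cinner x x = complex_of_real ((norm x)\<^sup>2)"
proof (rule complex_eqI)
  show "Re (cinner x x) = Re (complex_of_real ((norm x)\<^sup>2))"
    by (simp flip: inner_eq_Re_cinner add: dot_square_norm)
  show "Im (cinner x x) = Im (complex_of_real ((norm x)\<^sup>2))"
    using arg_cong[OF cinner_commute[of x x], of Im] by simp
qed

lemma cinner_self_eq_0 [simp]: "cinner x x = 0 \<longleftrightarrow> x = 0"
  by (simp add: cinner_self)

lemma cinner_eq_0_commute: "cinner x y = 0 \<longleftrightarrow> cinner y x = 0"
  by (metis cinner_commute complex_cnj_zero)

lemma cinner_ext_right: "(\<And>x. cinner x y = cinner x z) \<Longrightarrow> y = z"
  by (metis cinner_diff_right cinner_self_eq_0 eq_iff_diff_eq_0)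

text \<open>
  The imaginary part of \<open>cinner x y\<close> is the real inner product of x with a rotation of y; this
  transfers facts from the underlying real Hilbert space to the complex one.
\<close>
lemma cinner_eq_0_iff_inner: "cinner x y = 0 \<longleftrightarrow> inner x y = 0 \<and> inner x (\<i> *\<^sub>C y) = 0"
  by (auto simp: inner_eq_Re_cinner cinner_scaleC_right complex_eq_iff)

lemma norm_scaleC: "norm (c *\<^sub>C x) = cmod c * norm (x::'a::complex_hilbert)"
proof -
  have "complex_of_real ((norm (c *\<^sub>C x))\<^sup>2) = complex_of_real ((cmod c * norm x)\<^sup>2)"
    unfolding cinner_self[symmetric] cinner_scaleC_left cinner_scaleC_right
    by (simp add: cinner_self power_mult_distrib complex_norm_square del: of_real_power)
  then have "(norm (c *\<^sub>C x))\<^sup>2 = (cmod c * norm x)\<^sup>2"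
    using of_real_eq_iff by blast
  then show ?thesis by (simp add: power2_eq_iff_nonneg)
qed

text \<open>
  Rotating x makes \<open>cinner x y\<close> real, which reduces the claim to the real Cauchy-Schwarz inequality.
\<close>
lemma norm_cinner_le: "cmod (cinner x y) \<le> norm x * norm y"
proof -
  obtain c where c: "cmod c = 1" "c * cinner x y = complex_of_real (cmod (cinner x y))"
  proof (cases "cinner x y = 0")
    case True
    then show ?thesis using that[of 1] by simp
  next
    case False
    then show ?thesis
      using that[of "cnj (cinner x y) / cmod (cinner x y)"] complex_norm_square[of "cinner x y"]
      by (simp add: norm_divide field_simps power2_eq_square)
  qed
  then have "cmod (cinner x y) = inner (c *\<^sub>C x) y"
    by (simp add: inner_eq_Re_cinner cinner_scaleC_left)
  also have "\<dots> \<le> norm (c *\<^sub>C x) * norm y"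
    by (rule norm_cauchy_schwarz)
  finally show ?thesis using c by (simp add: norm_scaleC)
qed

lemma bounded_linear_scaleC: "bounded_linear (\<lambda>x::'a::complex_hilbert. c *\<^sub>C x)"
  by (rule bounded_linear_intro[where K = "cmod c"])
    (simp_all add: scaleC_add_right scaleR_eq_scaleC scaleC_scaleC norm_scaleC mult.commute)

lemma bounded_linear_cinner_left: "bounded_linear (\<lambda>x. cinner x y)"
  by (rule bounded_linear_intro[where K = "norm y"])
    (simp_all add: cinner_add_left scaleR_eq_scaleC cinner_scaleC_left norm_cinner_le
      flip: scaleR_conv_of_real)

lemma closed_cinner_eq_0: "closed {x. cinner x y = 0}"
  by (intro closed_Collect_eq linear_continuous_on bounded_linear_cinner_left continuous_on_const)

lemma csubspaceD:
  assumes "csubspace M"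
  shows "0 \<in> M" "x \<in> M \<Longrightarrow> y \<in> M \<Longrightarrow> x + y \<in> M" "x \<in> M \<Longrightarrow> c *\<^sub>C x \<in> M"
    "x \<in> M \<Longrightarrow> - x \<in> M" "x \<in> M \<Longrightarrow> y \<in> M \<Longrightarrow> x - y \<in> M"
proof -
  show *: "0 \<in> M" "x \<in> M \<Longrightarrow> y \<in> M \<Longrightarrow> x + y \<in> M" "x \<in> M \<Longrightarrow> c *\<^sub>C x \<in> M" for x y c
    using assms unfolding csubspace_def by auto
  show **: "x \<in> M \<Longrightarrow> - x \<in> M" for x using *(3)[of x "-1"] by simp
  show "x \<in> M \<Longrightarrow> y \<in> M \<Longrightarrow> x - y \<in> M" using *(2)[of x "-y"] **[of y] by simp
qed

lemma csubspace_imp_subspace: "csubspace M \<Longrightarrow> subspace M"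
  by (auto simp: subspace_def csubspaceD scaleR_eq_scaleC)

lemma closed_csubspaceD:
  assumes "closed_csubspace M"
  shows "csubspace M" "closed M"
  using assms by (auto simp: closed_csubspace_def)

lemma closed_csubspace_INT:
  assumes "\<And>i. i \<in> I \<Longrightarrow> closed_csubspace (M i)"
  shows "closed_csubspace (\<Inter>i\<in>I. M i)"
  using assms by (auto simp: closed_csubspace_def csubspace_def)

lemma closed_csubspace_Int:
  "closed_csubspace M \<Longrightarrow> closed_csubspace N \<Longrightarrow> closed_csubspace (M \<inter> N)"
  by (auto simp: closed_csubspace_def csubspace_def)

lemma closed_csubspace_UNIV [simp]: "closed_csubspace UNIV"
  by (auto simp: closed_csubspace_def csubspace_def)

lemma closed_csubspace_ortho_complement [simp]: "closed_csubspace (ortho_complement M)"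
proof -
  have eq: "ortho_complement M = (\<Inter>y\<in>M. {x. cinner x y = 0})"
    by (auto simp: ortho_complement_def)
  have "closed_csubspace {x. cinner x y = 0}" for y :: 'a
    by (auto simp: closed_csubspace_def closed_cinner_eq_0 csubspace_def cinner_add_left
        cinner_scaleC_left)
  then show ?thesis unfolding eq by (rule closed_csubspace_INT)
qed

lemma ortho_complement_antimono: "M \<subseteq> N \<Longrightarrow> ortho_complement N \<subseteq> ortho_complement M"
  by (auto simp: ortho_complement_def)

lemma subset_double_ortho_complement: "M \<subseteq> ortho_complement (ortho_complement M)"
  by (auto simp: ortho_complement_def cinner_eq_0_commute)

definition closed_span :: "'a::complex_hilbert set \<Rightarrow> 'a set"
  where "closed_span X = closure (csubspace hull X)"

lemma csubspace_hull: "csubspace (csubspace hull X)"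
  unfolding hull_def csubspace_def by auto

lemma csubspace_closure:
  assumes "csubspace M"
  shows "csubspace (closure M)"
proof -
  have "c *\<^sub>C x \<in> closure M" if "x \<in> closure M" for c x
  proof -
    have "(\<lambda>x. c *\<^sub>C x) ` closure M \<subseteq> closure M"
      by (rule image_closure_subset)
        (auto intro: linear_continuous_on bounded_linear_scaleC
          simp: csubspaceD[OF assms] closure_subset[THEN subsetD])
    with that show ?thesis by auto
  qed
  moreover have "x + y \<in> closure M" if "x \<in> closure M" "y \<in> closure M" for x y
  proof -
    have "(\<lambda>y. z + y) ` closure M \<subseteq> closure M" if "z \<in> M" for z
      by (rule image_closure_subset)
        (auto intro!: continuous_intros simp: csubspaceD[OF assms] that closure_subset[THEN subsetD])
    then have "(\<lambda>z. z + y) ` closure M \<subseteq> closure M"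
      by (intro image_closure_subset) (use that in \<open>auto intro!: continuous_intros\<close>)
    with that show ?thesis by auto
  qed
  ultimately show ?thesis
    using csubspaceD(1)[OF assms] closure_subset[of M] by (auto simp: csubspace_def)
qed

lemma closed_csubspace_closed_span [simp]: "closed_csubspace (closed_span X)"
  by (simp add: closed_csubspace_def closed_span_def csubspace_closure csubspace_hull)

lemma closed_span_superset: "X \<subseteq> closed_span X"
  unfolding closed_span_def by (meson closure_subset hull_subset order_trans)

lemma closed_span_minimal: "X \<subseteq> L \<Longrightarrow> closed_csubspace L \<Longrightarrow> closed_span X \<subseteq> L"
  unfolding closed_span_def closed_csubspace_def by (simp add: closure_minimal hull_minimal)

lemma closed_span_mono: "X \<subseteq> Y \<Longrightarrow> closed_span X \<subseteq> closed_span Y"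
  by (meson closed_csubspace_closed_span closed_span_minimal closed_span_superset order_trans)

text \<open>
  A vector orthogonal to X has a closed orthogonal complement containing X, hence also its closed span.
\<close>
lemma ortho_complement_closed_span: "ortho_complement (closed_span X) = ortho_complement X"
proof
  show "ortho_complement X \<subseteq> ortho_complement (closed_span X)"
  proof
    fix x assume "x \<in> ortho_complement X"
    then have "X \<subseteq> ortho_complement {x}"
      by (auto simp: ortho_complement_def cinner_eq_0_commute)
    then have "closed_span X \<subseteq> ortho_complement {x}"
      by (simp add: closed_span_minimal)
    then show "x \<in> ortho_complement (closed_span X)"
      by (auto simp: ortho_complement_def cinner_eq_0_commute)
  qed
qed (simp add: ortho_complement_antimono closed_span_superset)

section \<open>Orthogonal projections\<close>

text \<open>
  Points of M that almost realise the distance to x lie close together by the parallelogram law,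
  so by completeness the distance is attained, at a point p; perturbing p inside M shows that
  \<open>x - p\<close> is orthogonal to M.
\<close>
lemma orthogonal_decomposition_exists:
  assumes M: "closed_csubspace M"
  shows "\<exists>p\<in>M. x - p \<in> ortho_complement M"
proof -
  note cs = csubspaceD[OF closed_csubspaceD(1)[OF M]]
  have sub: "subspace M" by (rule csubspace_imp_subspace[OF closed_csubspaceD(1)[OF M]])
  have ne: "M \<noteq> {}" using cs(1) by auto
  define d where "d = infdist x M"
  have d0: "0 \<le> d" by (simp add: d_def infdist_nonneg)
  define S where "S n = M \<inter> cball x (d + inverse (real (Suc n)))" for n
  have close: "(dist a b)\<^sup>2 \<le> 4 * ((d + r)\<^sup>2 - d\<^sup>2)"
    if "a \<in> M" "b \<in> M" "dist x a \<le> d + r" "dist x b \<le> d + r" for a b r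
  proof -
    \<comment> \<open>The midpoint lies in M, so the parallelogram law leaves little room for \<open>a - b\<close>.\<close>
    have mid: "(1/2) *\<^sub>R (a + b) \<in> M"
      using that sub by (simp add: subspace_add subspace_scale)
    have "d \<le> dist x ((1/2) *\<^sub>R (a + b))"
      unfolding d_def by (rule infdist_le[OF mid])
    then have "d\<^sup>2 \<le> (norm (x - (1/2) *\<^sub>R (a + b)))\<^sup>2"
      using d0 by (simp add: dist_norm)
    moreover have "(norm (a - b))\<^sup>2 + 4 * (norm (x - (1/2) *\<^sub>R (a + b)))\<^sup>2
        = 2 * (norm (x - a))\<^sup>2 + 2 * (norm (x - b))\<^sup>2"
      unfolding power2_norm_eq_inner by (simp add: inner_simps inner_commute field_simps)
    moreover have "(norm (x - a))\<^sup>2 \<le> (d + r)\<^sup>2" "(norm (x - b))\<^sup>2 \<le> (d + r)\<^sup>2"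
      using that by (simp_all add: dist_norm power_mono)
    ultimately show ?thesis by (simp add: dist_norm)
  qed
  obtain p where p: "\<And>n. p \<in> S n"
  proof (rule decreasing_closed_nest[of S])
    show "closed (S n)" for n using closed_csubspaceD(2)[OF M] by (auto simp: S_def)
    show "S n \<noteq> {}" for n
    proof -
      have "infdist x M < d + inverse (real (Suc n))" by (simp add: d_def)
      then obtain y where "y \<in> M" "dist x y < d + inverse (real (Suc n))"
        using cINF_less_iff[of M "dist x"] ne bdd_below_image_dist
        by (metis bdd_below.I2 infdist_notempty zero_le_dist)
      then show ?thesis unfolding S_def by force
    qed
    show "S n \<subseteq> S m" if "m \<le> n" for m n
      using that unfolding S_def
      by (intro Int_mono order_refl subset_cball) (simp add: le_imp_inverse_le)
    show "\<exists>n. \<forall>a\<in>S n. \<forall>b\<in>S n. dist a b < e" if "e > 0" for e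
    proof -
      have "(\<lambda>n. 4 * ((d + inverse (real (Suc n)))\<^sup>2 - d\<^sup>2)) \<longlonglongrightarrow> 4 * ((d + 0)\<^sup>2 - d\<^sup>2)"
        by (intro tendsto_intros LIMSEQ_inverse_real_of_nat)
      then have "eventually (\<lambda>n. 4 * ((d + inverse (real (Suc n)))\<^sup>2 - d\<^sup>2) < e\<^sup>2) sequentially"
        using that by (intro order_tendstoD(2)) auto
      then obtain n where n: "4 * ((d + inverse (real (Suc n)))\<^sup>2 - d\<^sup>2) < e\<^sup>2"
        by (auto simp: eventually_sequentially)
      have "dist a b < e" if "a \<in> S n" "b \<in> S n" for a b
      proof -
        have "(dist a b)\<^sup>2 < e\<^sup>2"
          using close[of a b "inverse (real (Suc n))"] that n by (simp add: S_def)
        then show ?thesis using \<open>e > 0\<close> by (simp add: power_less_imp_less_base)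
      qed
      then show ?thesis by blast
    qed
  qed (blast intro: that)
  have pM: "p \<in> M" using p by (simp add: S_def)
  have "dist x p \<le> d + inverse (real (Suc n))" for n using p[of n] by (simp add: S_def)
  then have "dist x p \<le> d + 0"
    by (intro LIMSEQ_le_const[OF tendsto_add[OF tendsto_const LIMSEQ_inverse_real_of_nat]]) auto
  then have min: "norm (x - p) \<le> norm (x - y)" if "y \<in> M" for y
    using infdist_le[OF that, of x] by (simp add: d_def dist_norm)
  have "inner (x - p) y = 0" if y: "y \<in> M" for y
  proof (cases "y = 0")
    case False
    \<comment> \<open>This t minimises the distance from \<open>x - p\<close> to the line spanned by y.\<close>
    define t where "t = inner (x - p) y / (norm y)\<^sup>2"
    have "p + t *\<^sub>R y \<in> M" using sub pM y by (simp add: subspace_add subspace_scale)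
    then have "(norm (x - p))\<^sup>2 \<le> (norm ((x - p) - t *\<^sub>R y))\<^sup>2"
      using min by (simp add: diff_diff_eq)
    also have "\<dots> = (norm (x - p))\<^sup>2 - 2 * t * inner (x - p) y + t\<^sup>2 * (norm y)\<^sup>2"
      unfolding power2_norm_eq_inner
      by (simp add: inner_simps inner_commute power2_eq_square algebra_simps)
    also have "\<dots> = (norm (x - p))\<^sup>2 - (inner (x - p) y)\<^sup>2 / (norm y)\<^sup>2"
      using False by (simp add: t_def power2_eq_square field_simps)
    finally have "(inner (x - p) y)\<^sup>2 / (norm y)\<^sup>2 \<le> 0" by simp
    then show ?thesis using False by (simp add: divide_le_0_iff)
  qed simp
  then have "cinner (x - p) y = 0" if "y \<in> M" for y
    using that cs(3)[OF that] by (simp add: cinner_eq_0_iff_inner)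
  with pM show ?thesis by (auto simp: ortho_complement_def)
qed

lemma ortho_complement_Int_eq_0:
  "x \<in> M \<Longrightarrow> x \<in> ortho_complement M \<Longrightarrow> x = 0"
  by (auto simp: ortho_complement_def)

definition proj :: "'a::complex_hilbert set \<Rightarrow> 'a \<Rightarrow> 'a"
  where "proj M x = (THE p. p \<in> M \<and> x - p \<in> ortho_complement M)"

lemma proj_eqI:
  assumes M: "closed_csubspace M" and p: "p \<in> M" "x - p \<in> ortho_complement M"
  shows "proj M x = p"
  unfolding proj_def
proof (rule the_equality)
  fix q assume q: "q \<in> M \<and> x - q \<in> ortho_complement M"
  have "q - p \<in> M" using q p M by (simp add: csubspaceD closed_csubspaceD)
  moreover have "(x - p) - (x - q) \<in> ortho_complement M"
    by (rule csubspaceD(5)[OF closed_csubspaceD(1)]) (use q p in auto)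
  ultimately have "q - p = 0" by (intro ortho_complement_Int_eq_0[of _ M]) simp_all
  then show "q = p" by simp
qed (use p in simp)

lemma proj_in: "closed_csubspace M \<Longrightarrow> proj M x \<in> M"
  and proj_diff: "closed_csubspace M \<Longrightarrow> x - proj M x \<in> ortho_complement M"
  using orthogonal_decomposition_exists proj_eqI by metis+

lemma proj_ident: "closed_csubspace M \<Longrightarrow> x \<in> M \<Longrightarrow> proj M x = x"
  by (rule proj_eqI) (auto simp: csubspaceD closed_csubspaceD)

lemma double_ortho_complement:
  assumes M: "closed_csubspace M"
  shows "ortho_complement (ortho_complement M) = M"
proof
  show "ortho_complement (ortho_complement M) \<subseteq> M"
  proof
    fix x assume x: "x \<in> ortho_complement (ortho_complement M)"
    have "x - proj M x \<in> ortho_complement (ortho_complement M)"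
      using x proj_in[OF M, of x] subset_double_ortho_complement[of M]
      by (intro csubspaceD(5)[OF closed_csubspaceD(1)]) auto
    then have "x - proj M x = 0"
      by (rule ortho_complement_Int_eq_0[OF proj_diff[OF M]])
    then show "x \<in> M" using proj_in[OF M, of x] by simp
  qed
qed (rule subset_double_ortho_complement)

lemma double_ortho_complement_eq_closed_span:
  "ortho_complement (ortho_complement X) = closed_span X"
  by (metis closed_csubspace_closed_span double_ortho_complement ortho_complement_closed_span)

section \<open>Bounded operators and adjoints\<close>

lemma bounded_op_onD:
  assumes "bounded_op_on UNIV T"
  shows "T (x + y) = T x + T y" "T (c *\<^sub>C x) = c *\<^sub>C T x" "T 0 = 0" "T (x - y) = T x - T y"
proof -
  show *: "T (x + y) = T x + T y" "T (c *\<^sub>C x) = c *\<^sub>C T x" for x y c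
    using assms by (auto simp: bounded_op_on_def)
  show "T 0 = 0" using *(2)[of 0 0] by simp
  show "T (x - y) = T x - T y" using *(1)[of x "(-1) *\<^sub>C y"] *(2)[of "-1" y] by simp
qed

lemma bounded_op_on_imp_bounded_linear:
  assumes "bounded_op_on UNIV T"
  shows "bounded_linear T"
proof -
  obtain B where "\<And>x. norm (T x) \<le> B * norm x"
    using assms unfolding bounded_op_on_def by auto
  then show ?thesis
    using bounded_op_onD[OF assms]
    by (intro bounded_linear_intro[where K = B]) (simp_all add: scaleR_eq_scaleC mult.commute)
qed

lemma bounded_op_on_comp:
  assumes "bounded_op_on UNIV S" "bounded_op_on UNIV T"
  shows "bounded_op_on UNIV (S \<circ> T)"
proof -
  have "bounded_linear (S \<circ> T)"
    using assms by (simp add: bounded_linear_compose bounded_op_on_imp_bounded_linear comp_def)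
  then obtain B where "\<And>x. norm ((S \<circ> T) x) \<le> norm x * B"
    using bounded_linear.bounded by blast
  then have "\<exists>B. \<forall>x. norm ((S \<circ> T) x) \<le> B * norm x" by (metis mult.commute)
  then show ?thesis
    using bounded_op_onD[OF assms(1)] bounded_op_onD[OF assms(2)]
    unfolding bounded_op_on_def by simp
qed

lemma bounded_op_on_id: "bounded_op_on UNIV id"
  by (auto simp: bounded_op_on_def intro!: exI[of _ 1])

lemma bounded_op_on_funpow: "bounded_op_on UNIV T \<Longrightarrow> bounded_op_on UNIV (T ^^ n)"
  by (induction n) (use bounded_op_on_id bounded_op_on_comp in \<open>auto simp: id_def\<close>)

lemma bounded_op_on_subset:
  "bounded_op_on UNIV T \<Longrightarrow> T ` K \<subseteq> K \<Longrightarrow> bounded_op_on K T"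
  by (auto simp: bounded_op_on_def)

lemma closed_csubspace_vimage:
  assumes T: "bounded_op_on UNIV T" and L: "closed_csubspace L"
  shows "closed_csubspace (T -` L)"
proof -
  have "closed (T -` L)"
    using closed_csubspaceD(2)[OF L] bounded_op_on_imp_bounded_linear[OF T]
    by (simp add: closed_vimage linear_continuous_on)
  then show ?thesis
    using bounded_op_onD[OF T] csubspaceD[OF closed_csubspaceD(1)[OF L]]
    by (auto simp: closed_csubspace_def csubspace_def)
qed

lemma image_closed_span_subset:
  assumes T: "bounded_op_on UNIV T" and "T ` X \<subseteq> L" "closed_csubspace L"
  shows "T ` closed_span X \<subseteq> L"
  using closed_span_minimal[of X "T -` L"] closed_csubspace_vimage[OF T assms(3)] assms(2) by auto

text \<open>The Riesz representation theorem, applied to the functional \<open>\<lambda>x. cinner (T x) y\<close>.\<close>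
lemma adjoint_vector_exists:
  assumes T: "bounded_op_on UNIV T"
  shows "\<exists>z. \<forall>x. cinner (T x) y = cinner x z"
proof -
  define f where "f x = cinner (T x) y" for x
  note f_simps = bounded_op_onD[OF T] cinner_add_left cinner_scaleC_left cinner_diff_left
  define K where "K = T -` {x. cinner x y = 0}"
  have "closed_csubspace {x. cinner x y = 0}"
    using closed_csubspace_ortho_complement[of "{y}"] by (simp add: ortho_complement_def)
  then have K: "closed_csubspace K"
    unfolding K_def by (rule closed_csubspace_vimage[OF T])
  have K_iff: "x \<in> K \<longleftrightarrow> f x = 0" for x by (simp add: K_def f_def)
  show ?thesis
  proof (cases "\<forall>x. f x = 0")
    case True
    then show ?thesis by (auto simp: f_def intro!: exI[of _ 0])
  next
    case False
    then obtain x0 where x0: "f x0 \<noteq> 0" by blast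
    \<comment> \<open>The kernel K has codimension one, so its complement is spanned by u.\<close>
    define u where "u = x0 - proj K x0"
    have u: "u \<in> ortho_complement K" unfolding u_def by (rule proj_diff[OF K])
    have "f (proj K x0) = 0" using proj_in[OF K] K_iff by blast
    then have fu: "f u \<noteq> 0" using x0 by (simp add: u_def f_def f_simps)
    then have "u \<noteq> 0" by (auto simp: f_def f_simps)
    have "f x = cinner x ((cnj (f u) / (norm u)\<^sup>2) *\<^sub>C u)" for x
    proof -
      have "f (x - (f x / f u) *\<^sub>C u) = 0" using fu by (simp add: f_def f_simps)
      then have "cinner (x - (f x / f u) *\<^sub>C u) u = 0"
        using u K_iff by (auto simp: ortho_complement_def cinner_eq_0_commute)
      then have "cinner x u = f x / f u * (norm u)\<^sup>2"
        by (simp add: cinner_diff_left cinner_scaleC_left cinner_self)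
      then show ?thesis using fu \<open>u \<noteq> 0\<close> by (simp add: cinner_scaleC_right)
    qed
    then show ?thesis unfolding f_def by blast
  qed
qed

lemma cadjoint:
  assumes T: "bounded_op_on UNIV T"
  shows "cinner (T x) y = cinner x (cadjoint T y)"
proof -
  obtain S where S: "\<forall>x y. cinner (T x) y = cinner x (S y)"
    using adjoint_vector_exists[OF T] by metis
  have "cadjoint T = S"
    unfolding cadjoint_def
  proof (rule the_equality)
    fix R assume "\<forall>x y. cinner (T x) y = cinner x (R y)"
    with S show "R = S" by (metis cinner_ext_right ext)
  qed (rule S)
  with S show ?thesis by simp
qed

lemma cadjoint': "bounded_op_on UNIV T \<Longrightarrow> cinner (cadjoint T x) y = cinner x (T y)"
  using cadjoint[of T y x] cinner_commute[of "cadjoint T x" y] cinner_commute[of x "T y"] by simp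

lemma bounded_op_on_cadjoint:
  assumes T: "bounded_op_on UNIV T"
  shows "bounded_op_on UNIV (cadjoint T)"
proof -
  obtain B where B: "B > 0" "\<And>x. norm (T x) \<le> norm x * B"
    using bounded_linear.pos_bounded[OF bounded_op_on_imp_bounded_linear[OF T]] by blast
  have "norm (cadjoint T y) \<le> B * norm y" for y
  proof (cases "cadjoint T y = 0")
    case False
    let ?z = "cadjoint T y"
    have "complex_of_real ((norm ?z)\<^sup>2) = cinner (T ?z) y"
      by (simp add: cadjoint[OF T] cinner_self)
    then have "(norm ?z)\<^sup>2 = cmod (cinner (T ?z) y)"
      by (auto simp flip: of_real_power dest: arg_cong[of _ _ cmod])
    also have "\<dots> \<le> norm (T ?z) * norm y" by (rule norm_cinner_le)
    also have "\<dots> \<le> norm ?z * B * norm y" by (simp add: B(2) mult_right_mono)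
    finally show ?thesis using False by (simp add: power2_eq_square)
  qed (use B in simp)
  moreover have "cadjoint T (x + y) = cadjoint T x + cadjoint T y"
    "cadjoint T (c *\<^sub>C x) = c *\<^sub>C cadjoint T x" for x y c
    by (rule cinner_ext_right,
        simp add: cinner_add_right cinner_scaleC_right flip: cadjoint[OF T])+
  ultimately show ?thesis by (auto simp: bounded_op_on_def)
qed

lemma cadjoint_cadjoint:
  assumes "bounded_op_on UNIV T"
  shows "cadjoint (cadjoint T) = T"
proof (rule ext, rule cinner_ext_right)
  fix x y
  show "cinner x (cadjoint (cadjoint T) y) = cinner x (T y)"
    using cadjoint[OF bounded_op_on_cadjoint[OF assms], of x y] cadjoint'[OF assms, of x y] by simp
qed

lemma cadjoint_comp:
  assumes S: "bounded_op_on UNIV S" and T: "bounded_op_on UNIV T"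
  shows "cadjoint (S \<circ> T) = cadjoint T \<circ> cadjoint S"
proof (rule ext, rule cinner_ext_right)
  fix x y
  show "cinner x (cadjoint (S \<circ> T) y) = cinner x ((cadjoint T \<circ> cadjoint S) y)"
    using cadjoint[OF bounded_op_on_comp[OF S T], of x y] cadjoint[OF S, of "T x" y]
      cadjoint[OF T, of x "cadjoint S y"] by simp
qed

lemma cinner_funpow_cadjoint:
  "bounded_op_on UNIV T \<Longrightarrow> cinner ((T ^^ n) x) y = cinner x ((cadjoint T ^^ n) y)"
  by (induction n arbitrary: x y) (simp_all add: cadjoint funpow_swap1)

text \<open>
  The defect space of T is thus the kernel of the adjoint, which every operator commuting
  with the adjoint preserves.
\<close>
lemma ortho_complement_range:
  assumes "bounded_op_on UNIV T"
  shows "ortho_complement (range T) = {x. cadjoint T x = 0}"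
proof -
  have "(\<forall>y. cinner x (T y) = 0) \<longleftrightarrow> cadjoint T x = 0" for x
  proof
    assume "\<forall>y. cinner x (T y) = 0"
    then have "cinner (cadjoint T x) (cadjoint T x) = 0"
      using cadjoint'[OF assms, of x "cadjoint T x"] by simp
    then show "cadjoint T x = 0" by simp
  next
    assume "cadjoint T x = 0"
    then show "\<forall>y. cinner x (T y) = 0" by (simp flip: cadjoint'[OF assms])
  qed
  then show ?thesis by (auto simp: ortho_complement_def)
qed

section \<open>Reducing subspaces\<close>

text \<open>
  Passing to the adjoint turns invariance of the complement into invariance of M itself. In this form
  intersections of reducing subspaces are visibly reducing.
\<close>
lemma reduces_iff_cadjoint:
  assumes T: "bounded_op_on UNIV T"
  shows "reduces M T \<longleftrightarrow> closed_csubspace M \<and> T ` M \<subseteq> M \<and> cadjoint T ` M \<subseteq> M"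
proof (cases "closed_csubspace M")
  case True
  have "T ` ortho_complement M \<subseteq> ortho_complement M \<longleftrightarrow>
      cadjoint T ` M \<subseteq> ortho_complement (ortho_complement M)"
    unfolding image_subset_iff ortho_complement_def mem_Collect_eq cadjoint[OF T]
    by (meson cinner_eq_0_commute)
  then show ?thesis by (simp add: reduces_def double_ortho_complement True)
qed (simp add: reduces_def)

lemma reduces_closed: "reduces M T \<Longrightarrow> closed_csubspace M"
  and reduces_image: "reduces M T \<Longrightarrow> x \<in> M \<Longrightarrow> T x \<in> M"
  by (auto simp: reduces_def)

lemma reduces_cadjoint:
  "bounded_op_on UNIV T \<Longrightarrow> reduces M T \<Longrightarrow> reduces M (cadjoint T)"
  by (simp add: reduces_iff_cadjoint bounded_op_on_cadjoint cadjoint_cadjoint)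

lemma reduces_ortho_complement:
  "reduces M T \<Longrightarrow> reduces (ortho_complement M) T"
  by (simp add: reduces_def double_ortho_complement)

lemma reduces_Int:
  "bounded_op_on UNIV T \<Longrightarrow> reduces M T \<Longrightarrow> reduces N T \<Longrightarrow> reduces (M \<inter> N) T"
  by (auto simp: reduces_iff_cadjoint closed_csubspace_Int)

lemma reduces_INT:
  assumes "bounded_op_on UNIV T" "\<And>i. i \<in> I \<Longrightarrow> reduces (M i) T"
  shows "reduces (\<Inter>i\<in>I. M i) T"
  using assms by (simp add: reduces_iff_cadjoint closed_csubspace_INT) blast

text \<open>
  Both \<open>T (proj M x)\<close> and \<open>T (x - proj M x)\<close> stay in their respective summands, so they are
  the components of \<open>T x\<close>.
\<close>
lemma proj_reduces:
  assumes T: "bounded_op_on UNIV T" and M: "reduces M T"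
  shows "proj M (T x) = T (proj M x)"
proof (rule proj_eqI)
  show cl: "closed_csubspace M" using M by (rule reduces_closed)
  show "T (proj M x) \<in> M" using M by (simp add: reduces_image proj_in cl)
  have "T (x - proj M x) \<in> ortho_complement M"
    using M proj_diff[OF cl, of x] by (auto simp: reduces_def)
  then show "T x - T (proj M x) \<in> ortho_complement M"
    by (simp add: bounded_op_onD[OF T])
qed

lemma proj_funpow_reduces:
  "bounded_op_on UNIV T \<Longrightarrow> reduces M T \<Longrightarrow> proj M ((T ^^ n) x) = (T ^^ n) (proj M x)"
  by (induction n) (simp_all add: proj_reduces)

lemma bounded_op_on_proj:
  assumes M: "closed_csubspace M"
  shows "bounded_op_on UNIV (proj M)"
proof -
  note o = csubspaceD[OF closed_csubspaceD(1)[OF closed_csubspace_ortho_complement[of M]]]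
  note cs = csubspaceD[OF closed_csubspaceD(1)[OF M]]
  have "proj M (x + y) = proj M x + proj M y" for x y
    using o(2)[OF proj_diff[OF M, of x] proj_diff[OF M, of y]]
    by (intro proj_eqI[OF M] cs(2) proj_in[OF M]) (simp add: add_diff_add)
  moreover have "proj M (c *\<^sub>C x) = c *\<^sub>C proj M x" for c x
  proof (intro proj_eqI[OF M] cs(3) proj_in[OF M])
    have "c *\<^sub>C (x - proj M x) = c *\<^sub>C x - c *\<^sub>C proj M x"
      using scaleC_add_right[of c "x - proj M x" "proj M x"] by (simp add: algebra_simps)
    then show "c *\<^sub>C x - c *\<^sub>C proj M x \<in> ortho_complement M"
      using o(3)[OF proj_diff[OF M, of x], of c] by simp
  qed
  moreover have "norm (proj M x) \<le> norm x" for x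
  proof -
    have "cinner (x - proj M x) (proj M x) = 0"
      using proj_diff[OF M, of x] proj_in[OF M, of x] by (simp add: ortho_complement_def)
    then have "cinner x (proj M x) = complex_of_real ((norm (proj M x))\<^sup>2)"
      by (simp add: cinner_diff_left cinner_self)
    then have "(norm (proj M x))\<^sup>2 \<le> norm x * norm (proj M x)"
      using norm_cinner_le[of x "proj M x"] by (simp add: norm_power)
    then show ?thesis by (cases "proj M x = 0") (simp_all add: power2_eq_square)
  qed
  ultimately show ?thesis by (auto simp: bounded_op_on_def intro!: exI[of _ 1])
qed

section \<open>Operators bounded below\<close>

definition bounded_below :: "('a::real_normed_vector \<Rightarrow> 'a) \<Rightarrow> bool"
  where "bounded_below T \<longleftrightarrow> (\<exists>\<delta>>0. \<forall>x. \<delta> * norm x \<le> norm (T x))"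

lemma bounded_below_id: "bounded_below id"
  by (auto simp: bounded_below_def intro!: exI[of _ 1])

lemma bounded_below_comp:
  assumes "bounded_below S" "bounded_below T"
  shows "bounded_below (S \<circ> T)"
proof -
  obtain a b where a: "a > 0" "\<And>x. a * norm x \<le> norm (S x)"
    and b: "b > 0" "\<And>x. b * norm x \<le> norm (T x)"
    using assms unfolding bounded_below_def by blast
  have "a * b * norm x \<le> norm ((S \<circ> T) x)" for x
    using order_trans[OF mult_left_mono[OF b(2)[of x], of a] a(2)[of "T x"]] a(1)
    by (simp add: mult.assoc)
  then show ?thesis using a(1) b(1) unfolding bounded_below_def by (metis mult_pos_pos)
qed

lemma bounded_below_funpow: "bounded_below T \<Longrightarrow> bounded_below (T ^^ n)"
  by (induction n) (use bounded_below_id bounded_below_comp in \<open>auto simp: id_def\<close>)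

lemma bounded_below_inj:
  assumes T: "bounded_op_on UNIV T" and "bounded_below T"
  shows "inj T"
proof (rule injI)
  fix x y assume "T x = T y"
  then have "T (x - y) = 0" by (simp add: bounded_op_onD[OF T])
  then have "norm (x - y) \<le> 0"
    using assms(2) unfolding bounded_below_def by (metis mult_le_0_iff norm_zero not_le)
  then show "x = y" by simp
qed

text \<open>
  An operator bounded below pulls Cauchy sequences in the image back to Cauchy sequences in M. Closedness
  of the summands in the decompositions below rests on this.
\<close>
lemma closed_csubspace_image:
  assumes T: "bounded_op_on UNIV T" and b: "bounded_below T" and M: "closed_csubspace M"
  shows "closed_csubspace (T ` M)"
proof -
  note cs = csubspaceD[OF closed_csubspaceD(1)[OF M]]
  obtain e where "e > 0" "\<And>x. e * norm x \<le> norm (T x)"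
    using b unfolding bounded_below_def by blast
  then have "complete (T ` M)"
    using closed_csubspaceD[OF M]
    by (intro complete_isometric_image[of e] bounded_op_on_imp_bounded_linear T
        csubspace_imp_subspace) (simp_all add: complete_eq_closed)
  then have "closed (T ` M)" by (simp add: complete_eq_closed)
  moreover have "0 \<in> T ` M" using imageI[OF cs(1), of T] by (simp add: bounded_op_onD[OF T])
  moreover have "T x + T y \<in> T ` M" "c *\<^sub>C T x \<in> T ` M" if "x \<in> M" "y \<in> M" for x y c
    using imageI[OF cs(2)[OF that], of T] imageI[OF cs(3)[OF that(1)], of T c]
    by (simp_all add: bounded_op_onD[OF T])
  ultimately show ?thesis unfolding closed_csubspace_def csubspace_def by blast
qed

section \<open>The Wold decomposition of a near-isometry\<close>

definition defect :: "('a::complex_hilbert \<Rightarrow> 'a) \<Rightarrow> 'a set"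
  where "defect T = ortho_complement (range T)"

definition invertible_part :: "('a::complex_hilbert \<Rightarrow> 'a) \<Rightarrow> 'a set"
  where "invertible_part T = (\<Inter>n. range (T ^^ n))"

definition shift_part :: "('a::complex_hilbert \<Rightarrow> 'a) \<Rightarrow> 'a set"
  where "shift_part T = ortho_complement (invertible_part T)"

lemma near_isometryD:
  assumes "near_isometry T"
  shows "bounded_op_on UNIV T" "bounded_below T"
    "k \<ge> 1 \<Longrightarrow> (cadjoint T ^^ k) ((T ^^ (k + 1)) x) \<in> range T"
  using assms unfolding near_isometry_def bounded_below_def by (auto simp: image_subset_iff)

lemma closed_csubspace_defect [simp]: "closed_csubspace (defect T)"
  by (simp add: defect_def)

lemma defect_eq_kernel: "bounded_op_on UNIV T \<Longrightarrow> defect T = {x. cadjoint T x = 0}"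
  by (simp add: defect_def ortho_complement_range)

text \<open>
  For \<open>k \<ge> 1\<close>, moving \<open>T ^^ k\<close> to the other side produces
  \<open>(cadjoint T ^^ k) ((T ^^ Suc k) z)\<close>, which the range condition places in the range of T, hence
  orthogonal to w.
\<close>
lemma defect_orthogonal_power_range:
  assumes T: "near_isometry T" and w: "w \<in> defect T"
  shows "cinner ((T ^^ k) w) ((T ^^ Suc k) z) = 0"
proof (cases k)
  case 0
  then show ?thesis using w by (simp add: defect_def ortho_complement_def)
next
  case (Suc k')
  then have "(cadjoint T ^^ k) ((T ^^ (k + 1)) z) \<in> range T"
    by (intro near_isometryD(3)[OF T]) simp
  then have "cinner w ((cadjoint T ^^ k) ((T ^^ Suc k) z)) = 0"
    using w by (auto simp: defect_def ortho_complement_def)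
  then show ?thesis by (simp only: cinner_funpow_cadjoint[OF near_isometryD(1)[OF T]])
qed

lemma wandering_defect:
  assumes T: "near_isometry T" and "k \<noteq> l"
  shows "orthogonal_sets ((T ^^ k) ` defect T) ((T ^^ l) ` defect T)"
proof -
  have less: "cinner ((T ^^ k) w) ((T ^^ l) z) = 0" if "w \<in> defect T" "k < l" for k l w z
  proof -
    obtain j where "l = Suc k + j" using \<open>k < l\<close> less_iff_Suc_add by auto
    then have "(T ^^ l) z = (T ^^ Suc k) ((T ^^ j) z)"
      by (simp only: funpow_add comp_apply)
    then show ?thesis
      by (simp only: defect_orthogonal_power_range[OF T \<open>w \<in> defect T\<close>])
  qed
  show ?thesis
  proof (cases "k < l")
    case True
    then show ?thesis by (auto simp: orthogonal_sets_def less)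
  next
    case False
    then have "l < k" using \<open>k \<noteq> l\<close> by simp
    then show ?thesis
      unfolding orthogonal_sets_def using less cinner_eq_0_commute by blast
  qed
qed

text \<open>
  By the range condition, \<open>T ^^ n\<close> maps the splitting of the whole space into the range of T and its
  complement to an orthogonal splitting of the range of \<open>T ^^ n\<close>. So the ranges decrease by exactly
  one copy of the defect space at each step.
\<close>
lemma range_funpow_eq:
  assumes T: "near_isometry T"
  shows "range (T ^^ n) = ortho_complement (\<Union>j<n. (T ^^ j) ` defect T)"
proof (induction n)
  case 0
  then show ?case by (auto simp: ortho_complement_def)
next
  case (Suc n)
  note Tb = near_isometryD(1)[OF T]
  have perp: "cinner ((T ^^ Suc n) z) ((T ^^ j) w) = 0" if "j \<le> n" "w \<in> defect T" for z j w
  proof -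
    have "T ^^ Suc n = T ^^ (Suc j + (n - j))" using \<open>j \<le> n\<close> by simp
    then have "(T ^^ Suc n) z = (T ^^ Suc j) ((T ^^ (n - j)) z)"
      by (simp only: funpow_add comp_apply)
    moreover have "cinner ((T ^^ Suc j) ((T ^^ (n - j)) z)) ((T ^^ j) w) = 0"
      by (rule iffD1[OF cinner_eq_0_commute defect_orthogonal_power_range[OF T \<open>w \<in> defect T\<close>]])
    ultimately show ?thesis by simp
  qed
  show ?case
  proof
    show "range (T ^^ Suc n) \<subseteq> ortho_complement (\<Union>j<Suc n. (T ^^ j) ` defect T)"
      using perp unfolding ortho_complement_def
      by (auto simp: less_Suc_eq_le simp del: funpow.simps)
    show "ortho_complement (\<Union>j<Suc n. (T ^^ j) ` defect T) \<subseteq> range (T ^^ Suc n)"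
    proof
      fix x assume x: "x \<in> ortho_complement (\<Union>j<Suc n. (T ^^ j) ` defect T)"
      have "(\<Union>j<n. (T ^^ j) ` defect T) \<subseteq> (\<Union>j<Suc n. (T ^^ j) ` defect T)"
        unfolding lessThan_Suc by blast
      from ortho_complement_antimono[OF this] have "x \<in> range (T ^^ n)"
        unfolding Suc.IH using x by (rule subsetD)
      then obtain z where z: "x = (T ^^ n) z" by auto
      have cl: "closed_csubspace (range T)"
        by (rule closed_csubspace_image[OF Tb near_isometryD(2)[OF T]]) simp
      define w where "w = z - proj (range T) z"
      have w: "w \<in> defect T" unfolding w_def defect_def by (rule proj_diff[OF cl])
      obtain a where a: "proj (range T) z = T a" using proj_in[OF cl] by blast
      have "z = T a + w" using a by (simp add: w_def)
      then have x_eq: "x = (T ^^ Suc n) a + (T ^^ n) w"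
        by (simp add: z funpow_swap1 bounded_op_onD[OF bounded_op_on_funpow[OF Tb]])
      have "cinner x ((T ^^ n) w) = 0"
        using x w unfolding ortho_complement_def by blast
      then have "cinner ((T ^^ n) w) ((T ^^ n) w) = 0"
        unfolding x_eq using perp[of n w a] w
        by (simp add: cinner_add_left del: cinner_self_eq_0 funpow.simps)
      then have "x = (T ^^ Suc n) a" using x_eq by simp
      then show "x \<in> range (T ^^ Suc n)" by (rule range_eqI)
    qed
  qed
qed

lemma invertible_part_eq:
  assumes "near_isometry T"
  shows "invertible_part T = ortho_complement (\<Union>j. (T ^^ j) ` defect T)"
proof -
  have "(\<Union>n. \<Union>j<n. X j) = (\<Union>j. X j)" for X :: "nat \<Rightarrow> 'a set"
    by (fastforce intro: lessI)
  moreover have "(\<Inter>n. ortho_complement (X n)) = ortho_complement (\<Union>n. X n)"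
    for X :: "nat \<Rightarrow> 'a set"
    by (auto simp: ortho_complement_def)
  ultimately show ?thesis
    unfolding invertible_part_def range_funpow_eq[OF assms] by simp
qed

lemma shift_part_eq:
  "near_isometry T \<Longrightarrow> shift_part T = closed_span (\<Union>j. (T ^^ j) ` defect T)"
  by (simp add: shift_part_def invertible_part_eq double_ortho_complement_eq_closed_span)

lemma defect_subset_shift_part: "near_isometry T \<Longrightarrow> (T ^^ n) ` defect T \<subseteq> shift_part T"
  unfolding shift_part_eq by (rule order_trans[OF _ closed_span_superset]) blast

text \<open>
  Invariance under T is visible from the ranges; invariance under the adjoint comes from the description
  as the complement of the images of the defect space, which T moves one step along.
\<close>
lemma reduces_invertible_part:
  assumes T: "near_isometry T"
  shows "reduces (invertible_part T) T"
proof -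
  note Tb = near_isometryD(1)[OF T]
  have "T x \<in> invertible_part T" if x: "x \<in> invertible_part T" for x
    unfolding invertible_part_def
  proof
    fix n
    obtain z where "x = (T ^^ n) z" using x unfolding invertible_part_def by blast
    then have "T x = (T ^^ n) (T z)" by (simp add: funpow_swap1)
    then show "T x \<in> range (T ^^ n)" by simp
  qed
  moreover have "cadjoint T x \<in> invertible_part T" if "x \<in> invertible_part T" for x
  proof -
    have "cinner x ((T ^^ Suc j) w) = 0" if "w \<in> defect T" for j w
      using \<open>x \<in> invertible_part T\<close> that unfolding invertible_part_eq[OF T] ortho_complement_def by blast
    then show ?thesis
      unfolding invertible_part_eq[OF T] ortho_complement_def by (auto simp: cadjoint'[OF Tb])
  qed
  ultimately show ?thesis
    by (auto simp: reduces_iff_cadjoint[OF Tb] invertible_part_eq[OF T])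
qed

text \<open>
  Both summands are compatible with every reducing subspace N: the projection onto N commutes with
  the powers of T, so it maps the invertible part into itself.
\<close>
lemma wold_decomposition:
  assumes T: "near_isometry T" and N: "reduces N T" and x: "x \<in> N"
  shows "\<exists>u \<in> N \<inter> invertible_part T. x - u \<in> N \<inter> shift_part T"
proof -
  note Tb = near_isometryD(1)[OF T]
  note cN = reduces_closed[OF N] and cU = reduces_closed[OF reduces_invertible_part[OF T]]
  note cNU = closed_csubspace_Int[OF cN cU]
  define u where "u = proj (N \<inter> invertible_part T) x"
  have u: "u \<in> N \<inter> invertible_part T" unfolding u_def by (rule proj_in[OF cNU])
  have xu: "x - u \<in> N" using x u by (simp add: csubspaceD[OF closed_csubspaceD(1)[OF cN]])
  have "cinner (x - u) v = 0" if v: "v \<in> invertible_part T" for v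
  proof -
    have "proj N v \<in> invertible_part T"
      unfolding invertible_part_def
    proof
      fix n
      obtain z where "v = (T ^^ n) z" using v unfolding invertible_part_def by blast
      then show "proj N v \<in> range (T ^^ n)" by (simp add: proj_funpow_reduces[OF Tb N])
    qed
    then have "cinner (x - u) (proj N v) = 0"
      using proj_diff[OF cNU, of x] proj_in[OF cN, of v] unfolding u_def ortho_complement_def by simp
    moreover have "cinner (v - proj N v) (x - u) = 0"
      using proj_diff[OF cN, of v] xu unfolding ortho_complement_def by simp
    ultimately show ?thesis
      using cinner_eq_0_commute[of "x - u" "v - proj N v"]
        cinner_diff_right[of "x - u" v "proj N v"] by simp
  qed
  then have "x - u \<in> shift_part T" by (auto simp: shift_part_def ortho_complement_def)
  with u xu show ?thesis by auto
qed

text \<open>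
  The projection onto N fixes N and maps the spanning vectors \<open>(T ^^ n) w\<close> of the shift part to
  \<open>(T ^^ n) (proj N w)\<close>, where \<open>proj N w\<close> is again in the kernel of the adjoint.
\<close>
lemma reducing_subset_shift_part:
  assumes T: "near_isometry T" and N: "reduces N T" and sub: "N \<subseteq> shift_part T"
  shows "N = closed_span (\<Union>n. (T ^^ n) ` (N \<inter> defect T))" (is "N = closed_span ?X")
proof
  note Tb = near_isometryD(1)[OF T] and cN = reduces_closed[OF N]
  have "(T ^^ n) x \<in> N" if "x \<in> N" for n x
    using that by (induction n) (simp_all add: reduces_image[OF N])
  then show "closed_span ?X \<subseteq> N" by (intro closed_span_minimal cN) auto
  have "proj N ` (\<Union>j. (T ^^ j) ` defect T) \<subseteq> ?X"
  proof safe
    fix n w assume w: "w \<in> defect T"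
    have "cadjoint T (proj N w) = proj N (cadjoint T w)"
      by (rule proj_reduces[OF bounded_op_on_cadjoint[OF Tb] reduces_cadjoint[OF Tb N], symmetric])
    also have "\<dots> = 0"
      using w by (simp add: defect_eq_kernel[OF Tb] proj_ident cN csubspaceD closed_csubspaceD)
    finally have "proj N w \<in> N \<inter> defect T" by (simp add: proj_in cN defect_eq_kernel[OF Tb])
    then show "proj N ((T ^^ n) w) \<in> ?X" by (auto simp: proj_funpow_reduces[OF Tb N])
  qed
  then have *: "proj N ` shift_part T \<subseteq> closed_span ?X"
    unfolding shift_part_eq[OF T]
    by (intro image_closed_span_subset bounded_op_on_proj cN closed_csubspace_closed_span
        order_trans[OF _ closed_span_superset])
  show "N \<subseteq> closed_span ?X"
  proof
    fix x assume x: "x \<in> N"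
    then have "proj N x \<in> closed_span ?X" using * sub by blast
    then show "x \<in> closed_span ?X" by (simp only: proj_ident[OF cN x])
  qed
qed

text \<open>
  T maps the component of x orthogonal to N to the component of \<open>T x\<close> orthogonal to N, which
  vanishes; T is injective.
\<close>
lemma reducing_preimage:
  assumes T: "near_isometry T" and N: "reduces N T" and "T x \<in> N"
  shows "x \<in> N"
proof -
  note Tb = near_isometryD(1)[OF T] and cN = reduces_closed[OF N]
  have "T (proj N x) = T x"
    using proj_ident[OF cN \<open>T x \<in> N\<close>] by (simp add: proj_reduces[OF Tb N])
  then have "proj N x = x"
    using bounded_below_inj[OF Tb near_isometryD(2)[OF T]] by (simp add: inj_eq)
  then show ?thesis using proj_in[OF cN, of x] by simp
qed

lemma image_eq_of_reducing_subset_invertible_part: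
  assumes T: "near_isometry T" and N: "reduces N T" and sub: "N \<subseteq> invertible_part T"
  shows "T ` N = N"
proof
  show "T ` N \<subseteq> N" using N by (simp add: reduces_def)
  show "N \<subseteq> T ` N"
  proof
    fix y assume y: "y \<in> N"
    then have "y \<in> range (T ^^ 1)" using sub unfolding invertible_part_def by blast
    then obtain x where "y = T x" by auto
    then show "y \<in> T ` N" using reducing_preimage[OF T N] y by blast
  qed
qed

lemma shift_on_reducing:
  assumes T: "near_isometry T" and N: "reduces N T" and sub: "N \<subseteq> shift_part T"
  shows "shift_on N T"
proof -
  note Tb = near_isometryD(1)[OF T] and cN = reduces_closed[OF N]
  let ?W = "N \<inter> defect T"
  have cW: "closed_csubspace ?W" by (simp add: closed_csubspace_Int cN)
  have orth: "orthogonal_sets ((T ^^ k) ` ?W) ((T ^^ l) ` ?W)" if "k \<noteq> l" for k l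
    using wandering_defect[OF T that] unfolding orthogonal_sets_def by blast
  have "bounded_op_on N T"
    by (rule bounded_op_on_subset[OF Tb]) (use N in \<open>simp add: reduces_def\<close>)
  moreover have "wandering_on N T ?W"
    using cW orth by (auto simp: wandering_on_def)
  moreover have "orth_direct_sum (UNIV :: nat set) (\<lambda>k. (T ^^ k) ` ?W) N"
    unfolding orth_direct_sum_def
    using orth reducing_subset_shift_part[OF T N sub]
    by (auto simp: closed_span_def cW closed_csubspace_image bounded_op_on_funpow Tb
        bounded_below_funpow near_isometryD(2)[OF T])
  ultimately show ?thesis by (auto simp: shift_on_def)
qed

lemma invertible_on_reducing:
  assumes T: "near_isometry T" and N: "reduces N T" and sub: "N \<subseteq> invertible_part T"
  shows "invertible_on N T"
proof -
  note Tb = near_isometryD(1)[OF T] and cN = reduces_closed[OF N]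
  note cs = csubspaceD[OF closed_csubspaceD(1)[OF cN]]
  have bT: "bounded_op_on N T"
    by (rule bounded_op_on_subset[OF Tb]) (use N in \<open>simp add: reduces_def\<close>)
  define S where "S = inv T"
  have ST: "S (T x) = x" for x
    unfolding S_def by (rule inv_f_f[OF bounded_below_inj[OF Tb near_isometryD(2)[OF T]]])
  have TN: "T ` N = N" by (rule image_eq_of_reducing_subset_invertible_part[OF T N sub])
  have TS: "T (S x) = x" and SN: "S x \<in> N" if "x \<in> N" for x
  proof -
    obtain y where "y \<in> N" "x = T y" using TN \<open>x \<in> N\<close> by blast
    then show "T (S x) = x" "S x \<in> N" by (simp_all add: ST)
  qed
  obtain d where d: "d > 0" "\<And>x. d * norm x \<le> norm (T x)"
    using near_isometryD(2)[OF T] unfolding bounded_below_def by blast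
  have "norm (S x) \<le> (1 / d) * norm x" if "x \<in> N" for x
    using d(2)[of "S x"] d(1) TS[OF that] by (simp add: field_simps)
  moreover have "S (x + y) = S x + S y" if "x \<in> N" "y \<in> N" for x y
    using ST[of "S x + S y"] by (simp add: bounded_op_onD[OF Tb] TS that)
  moreover have "S (c *\<^sub>C x) = c *\<^sub>C S x" if "x \<in> N" for c x
    using ST[of "c *\<^sub>C S x"] by (simp add: bounded_op_onD[OF Tb] TS that)
  ultimately have "bounded_op_on N S"
    unfolding bounded_op_on_def using SN by blast
  then show ?thesis using bT ST TS by (auto simp: invertible_on_def)
qed

section \<open>Doubly commuting operators\<close>

text \<open>
  The relation is stated for an arbitrary operator R rather than another near-isometry, so that it
  also covers the adjoint of R; this yields reducing and not merely invariant subspaces.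
\<close>
definition doubly_commute :: "('a::complex_hilbert \<Rightarrow> 'a) \<Rightarrow> ('a \<Rightarrow> 'a) \<Rightarrow> bool"
  where "doubly_commute R T \<longleftrightarrow> R \<circ> T = T \<circ> R \<and> R \<circ> cadjoint T = cadjoint T \<circ> R"

lemma doubly_commute_cadjoint:
  assumes R: "bounded_op_on UNIV R" and T: "bounded_op_on UNIV T" and "doubly_commute R T"
  shows "doubly_commute (cadjoint R) T"
proof -
  note T' = bounded_op_on_cadjoint[OF T]
  have "cadjoint (R \<circ> T) = cadjoint (T \<circ> R)"
    "cadjoint (R \<circ> cadjoint T) = cadjoint (cadjoint T \<circ> R)"
    using assms(3) by (simp_all add: doubly_commute_def)
  then show ?thesis
    unfolding doubly_commute_def
    by (simp add: cadjoint_comp[OF R T] cadjoint_comp[OF T R] cadjoint_comp[OF R T']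
        cadjoint_comp[OF T' R] cadjoint_cadjoint[OF T])
qed

lemma doubly_commute_defect:
  assumes R: "bounded_op_on UNIV R" and T: "bounded_op_on UNIV T" and "doubly_commute R T"
  shows "reduces (defect T) R"
proof -
  have *: "Q x \<in> defect T" if "doubly_commute Q T" "Q 0 = 0" "x \<in> defect T" for Q x
  proof -
    have "cadjoint T (Q x) = Q (cadjoint T x)"
      using that(1) unfolding doubly_commute_def by (metis comp_apply)
    then show ?thesis using that(2,3) by (simp add: defect_eq_kernel[OF T])
  qed
  show ?thesis
    unfolding reduces_iff_cadjoint[OF R]
    using *[OF assms(3)] *[OF doubly_commute_cadjoint[OF assms]] bounded_op_onD(3)[OF R]
      bounded_op_onD(3)[OF bounded_op_on_cadjoint[OF R]] by auto
qed

lemma doubly_commute_invertible_part: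
  assumes R: "bounded_op_on UNIV R" and T: "near_isometry T" and "doubly_commute R T"
  shows "reduces (invertible_part T) R"
proof -
  have *: "Q x \<in> invertible_part T" if Q: "doubly_commute Q T" and x: "x \<in> invertible_part T" for Q x
    unfolding invertible_part_def
  proof
    fix n
    obtain z where z: "x = (T ^^ n) z" using x unfolding invertible_part_def by blast
    have "Q ((T ^^ n) z) = (T ^^ n) (Q z)"
      using Q unfolding doubly_commute_def
      by (induction n) (simp_all add: fun_eq_iff)
    then show "Q x \<in> range (T ^^ n)" by (simp add: z)
  qed
  show ?thesis
    unfolding reduces_iff_cadjoint[OF R]
    using *[OF assms(3)] *[OF doubly_commute_cadjoint[OF R near_isometryD(1)[OF T] assms(3)]]
    by (auto simp: invertible_part_eq[OF T])
qed

section \<open>Monomials in a doubly commuting tuple\<close>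

locale doubly_commuting_tuple =
  fixes T :: "nat \<Rightarrow> 'a::complex_hilbert \<Rightarrow> 'a" and I :: "nat set"
  assumes finite_I: "finite I"
    and near: "i \<in> I \<Longrightarrow> near_isometry (T i)"
    and commute: "i \<in> I \<Longrightarrow> j \<in> I \<Longrightarrow> i \<noteq> j \<Longrightarrow> doubly_commute (T i) (T j)"
begin

lemma bounded_op: "i \<in> I \<Longrightarrow> bounded_op_on UNIV (T i)"
  by (simp add: near near_isometryD)

lemma reduces_invertible: "i \<in> I \<Longrightarrow> j \<in> I \<Longrightarrow> reduces (invertible_part (T j)) (T i)"
  by (cases "i = j")
    (simp_all add: reduces_invertible_part doubly_commute_invertible_part near bounded_op commute)

lemma reduces_shift: "i \<in> I \<Longrightarrow> j \<in> I \<Longrightarrow> reduces (shift_part (T j)) (T i)"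
  by (simp add: shift_part_def reduces_ortho_complement reduces_invertible)

lemma reduces_defect: "i \<in> I \<Longrightarrow> j \<in> I \<Longrightarrow> i \<noteq> j \<Longrightarrow> reduces (defect (T j)) (T i)"
  by (simp add: doubly_commute_defect bounded_op commute)

lemma powers_commute:
  assumes "i \<in> I" "j \<in> I"
  shows "(T i ^^ m) ((T j ^^ n) x) = (T j ^^ n) ((T i ^^ m) x)"
proof -
  have one: "T i (T j y) = T j (T i y)" for y
    using commute[OF assms] unfolding doubly_commute_def by (cases "i = j") (auto simp: fun_eq_iff)
  have "T i ((T j ^^ n) y) = (T j ^^ n) (T i y)" for y
    by (induction n) (simp_all add: one)
  then show ?thesis by (induction m) simp_all
qed

lemma multi_power_empty [simp]: "multi_power T {} r = id"
  by (simp add: multi_power_def)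

lemma finite_subset_I: "A \<subseteq> I \<Longrightarrow> finite A"
  using finite_I by (rule rev_finite_subset)

text \<open>
  Any single factor may be moved to the front; this removes the dependence on the enumeration of A
  and permits induction over finite index sets.
\<close>
lemma multi_power_remove:
  assumes A: "A \<subseteq> I" and i: "i \<in> A"
  shows "multi_power T A r = (T i ^^ r i) \<circ> multi_power T (A - {i}) r"
proof -
  let ?F = "\<lambda>xs. foldr (\<lambda>i f. (T i ^^ r i) \<circ> f) xs id"
  have "?F xs = (T i ^^ r i) \<circ> ?F (remove1 i xs)" if "set xs \<subseteq> I" "i \<in> set xs" for xs
    using that
  proof (induction xs)
    case (Cons a xs)
    show ?case
    proof (cases "a = i")
      case False
      have I: "a \<in> I" "i \<in> I" using Cons.prems A i by auto
      have "?F xs = (T i ^^ r i) \<circ> ?F (remove1 i xs)"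
        by (rule Cons.IH) (use Cons.prems False in auto)
      then have "?F (a # xs) = (T a ^^ r a) \<circ> ((T i ^^ r i) \<circ> ?F (remove1 i xs))"
        by (simp only: foldr.simps comp_apply)
      also have "\<dots> = (T i ^^ r i) \<circ> ((T a ^^ r a) \<circ> ?F (remove1 i xs))"
        by (rule ext) (simp only: comp_apply powers_commute[OF I])
      also have "(T a ^^ r a) \<circ> ?F (remove1 i xs) = ?F (remove1 i (a # xs))"
        using False by simp
      finally show ?thesis .
    qed simp
  qed simp
  from this[of "sorted_list_of_set A"] show ?thesis
    using assms finite_subset_I[OF A] by (simp add: multi_power_def sorted_list_of_set_remove)
qed

lemma multi_power_insert:
  assumes "insert a A \<subseteq> I" "a \<notin> A"
  shows "multi_power T (insert a A) r = (T a ^^ r a) \<circ> multi_power T A r"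
  using multi_power_remove[OF assms(1), of a] assms(2) by simp

lemma multi_power_cong:
  assumes "finite A" "\<And>i. i \<in> A \<Longrightarrow> r i = r' i"
  shows "multi_power T A r = multi_power T A r'"
  unfolding multi_power_def by (rule foldr_cong) (simp_all add: assms)

lemma multi_power_bounded:
  assumes "A \<subseteq> I"
  shows "bounded_op_on UNIV (multi_power T A r) \<and> bounded_below (multi_power T A r)"
  using finite_subset_I[OF assms] assms
proof (induction A rule: finite_induct)
  case (insert a A)
  then show ?case
    unfolding multi_power_insert[OF insert.prems insert.hyps(2)]
    by (intro conjI bounded_op_on_comp bounded_below_comp bounded_op_on_funpow
        bounded_below_funpow near_isometryD[OF near]) auto
qed (simp add: bounded_op_on_id bounded_below_id)

lemma multi_power_invariant:
  assumes "A \<subseteq> I" "\<And>i. i \<in> A \<Longrightarrow> T i ` N \<subseteq> N"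
  shows "multi_power T A r ` N \<subseteq> N"
  using finite_subset_I[OF assms(1)] assms
proof (induction A rule: finite_induct)
  case (insert a A)
  have "(T a ^^ n) x \<in> N" if "x \<in> N" for n x
    using that insert.prems(2)[of a] by (induction n) auto
  with insert show ?case by (auto simp: multi_power_insert image_subset_iff)
qed simp

lemma multi_power_image_eq:
  assumes "A \<subseteq> I" "\<And>i. i \<in> A \<Longrightarrow> T i ` N = N"
  shows "multi_power T A r ` N = N"
  using finite_subset_I[OF assms(1)] assms
proof (induction A rule: finite_induct)
  case (insert a A)
  have "(T a ^^ n) ` N = N" for n
  proof (induction n)
    case (Suc n)
    have "(T a ^^ Suc n) ` N = T a ` ((T a ^^ n) ` N)" by (simp add: image_image)
    then show ?case using Suc insert.prems(2)[of a] by simp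
  qed simp
  moreover have "multi_power T A r ` N = N" using insert by simp
  ultimately show ?case
    by (simp only: multi_power_insert[OF insert.prems(1) insert.hyps(2)] flip: image_comp)
qed simp

section \<open>The joint Wold decomposition\<close>

definition wold_part :: "nat set \<Rightarrow> 'a set"
  where "wold_part A = (\<Inter>i\<in>A. shift_part (T i)) \<inter> (\<Inter>i\<in>I - A. invertible_part (T i))"

text \<open>
  The space that generates \<open>wold_part A\<close> under the monomials in the operators of A.
\<close>
definition wandering_part :: "nat set \<Rightarrow> 'a set"
  where "wandering_part A = defect_space T A \<inter> (\<Inter>i\<in>I - A. invertible_part (T i))"

lemma defect_space_eq: "defect_space T A = (\<Inter>i\<in>A. defect (T i))"
  by (simp add: defect_space_def defect_def)

lemma reduces_wold_part:
  assumes "A \<subseteq> I" "i \<in> I"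
  shows "reduces (wold_part A) (T i)"
  unfolding wold_part_def using assms
  by (intro reduces_Int reduces_INT bounded_op reduces_shift reduces_invertible) auto

lemma reduces_defect_space:
  assumes "A \<subseteq> I" "i \<in> I - A"
  shows "reduces (defect_space T A) (T i)"
  unfolding defect_space_eq using assms
  by (intro reduces_INT bounded_op reduces_defect) auto

lemma reduces_wandering_part:
  assumes "A \<subseteq> I" "i \<in> I - A"
  shows "reduces (wandering_part A) (T i)"
proof -
  have "reduces (\<Inter>j\<in>I - A. invertible_part (T j)) (T i)"
    using assms by (intro reduces_INT bounded_op reduces_invertible) auto
  then show ?thesis
    unfolding wandering_part_def using assms
    by (blast intro: reduces_Int bounded_op reduces_defect_space)
qed

lemma closed_csubspace_wandering_part:
  assumes "A \<subseteq> I"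
  shows "closed_csubspace (wandering_part A)"
  unfolding wandering_part_def defect_space_eq using assms
  by (intro closed_csubspace_Int closed_csubspace_INT closed_csubspace_defect)
    (auto intro: reduces_closed[OF reduces_invertible_part[OF near]])

text \<open>
  On the left-hand side every \<open>T i\<close> with i outside A acts bijectively, so all monomials in these
  operators leave it fixed as a set. Conversely, a monomial with exponent n at i has its image in the
  range of \<open>T i ^^ n\<close>, and monomials in operators outside A preserve the joint defect space of A.
\<close>
lemma wandering_part_eq:
  assumes A: "A \<subseteq> I"
  shows "wandering_part A =
    (\<Inter>j\<in>multi_indices (I - A). multi_power T (I - A) j ` defect_space T A)" (is "_ = ?R")
proof
  have "T i ` wandering_part A = wandering_part A" if "i \<in> I - A" for i
  proof (rule image_eq_of_reducing_subset_invertible_part)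
    show "near_isometry (T i)" using that by (simp add: near)
    show "reduces (wandering_part A) (T i)" using A that by (rule reduces_wandering_part)
    show "wandering_part A \<subseteq> invertible_part (T i)" using that by (auto simp: wandering_part_def)
  qed
  then have "multi_power T (I - A) j ` wandering_part A = wandering_part A" for j
    by (intro multi_power_image_eq) auto
  moreover have "wandering_part A \<subseteq> defect_space T A" by (simp add: wandering_part_def)
  ultimately show "wandering_part A \<subseteq> ?R" by (metis INT_greatest image_mono)
next
  \<comment> \<open>Constant multi-indices suffice: exponent 0 gives some monomial, exponent n the n-th range.\<close>
  have const: "restrict (\<lambda>_. n) (I - A) \<in> multi_indices (I - A)" for n
    by (auto simp: multi_indices_def)
  show "?R \<subseteq> wandering_part A"
  proof
    fix x assume x: "x \<in> ?R"
    have "multi_power T (I - A) j ` defect_space T A \<subseteq> defect_space T A" for j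
      by (rule multi_power_invariant) (use reduces_defect_space[OF A] in \<open>auto simp: reduces_def\<close>)
    then have "x \<in> defect_space T A" using x const by blast
    moreover have "x \<in> invertible_part (T i)" if i: "i \<in> I - A" for i
      unfolding invertible_part_def
    proof
      fix n
      have "x \<in> range (multi_power T (I - A) (restrict (\<lambda>_. n) (I - A)))"
        using x const[of n] by blast
      then show "x \<in> range (T i ^^ n)"
        using multi_power_remove[of "I - A" i] i by auto
    qed
    ultimately show "x \<in> wandering_part A" by (simp add: wandering_part_def)
  qed
qed

lemma wold_part_empty_eq:
  "wold_part {} = (\<Inter>r\<in>multi_indices I. range (multi_power T I r))"
  using wandering_part_eq[of "{}"]
  by (simp add: wold_part_def wandering_part_def defect_space_def)

text \<open>
  If the exponents differ at i, the two images lie in different powers of \<open>T i\<close> applied to the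
  defect space of \<open>T i\<close>, because the other factors preserve that defect space.
\<close>
lemma orthogonal_monomial_images:
  assumes A: "A \<subseteq> I" and r: "r \<in> multi_indices A" "r' \<in> multi_indices A" "r \<noteq> r'"
  shows "orthogonal_sets (multi_power T A r ` wandering_part A)
    (multi_power T A r' ` wandering_part A)"
proof -
  obtain i where i: "i \<in> A" "r i \<noteq> r' i"
    using r unfolding multi_indices_def by (metis PiE_ext)
  have sub: "multi_power T A s ` wandering_part A \<subseteq> (T i ^^ s i) ` defect (T i)" for s
  proof -
    have "T j ` defect (T i) \<subseteq> defect (T i)" if "j \<in> A - {i}" for j
      using reduces_defect[of j i] that A i by (auto simp: reduces_def)
    then have "multi_power T (A - {i}) s ` defect (T i) \<subseteq> defect (T i)"
      using A by (intro multi_power_invariant) auto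
    moreover have "wandering_part A \<subseteq> defect (T i)"
      using i by (auto simp: wandering_part_def defect_space_eq)
    ultimately have "multi_power T (A - {i}) s ` wandering_part A \<subseteq> defect (T i)" by blast
    then show ?thesis using multi_power_remove[OF A i(1), of s] by auto
  qed
  have "orthogonal_sets ((T i ^^ r i) ` defect (T i)) ((T i ^^ r' i) ` defect (T i))"
    using A i by (intro wandering_defect near) auto
  then show ?thesis using sub[of r] sub[of r'] unfolding orthogonal_sets_def by blast
qed

text \<open>
  The subspace N is generalised in the induction: after the operator a has been dealt with, the induction
  hypothesis is applied to \<open>N \<inter> defect (T a)\<close>, which reduces the remaining operators.
\<close>
lemma reducing_eq_monomial_span:
  assumes "A \<subseteq> I" "closed_csubspace N" "\<And>i. i \<in> A \<Longrightarrow> reduces N (T i)"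
    "\<And>i. i \<in> A \<Longrightarrow> N \<subseteq> shift_part (T i)"
  shows "N = closed_span (\<Union>r\<in>multi_indices A. multi_power T A r ` (N \<inter> defect_space T A))"
  using finite_subset_I[OF assms(1)] assms
proof (induction A arbitrary: N rule: finite_induct)
  case empty
  have "closed_span N = N"
    using closed_span_minimal[of N N] closed_span_superset[of N] empty.prems(2) by simp
  then show ?case by (simp add: multi_indices_def defect_space_def)
next
  case (insert a A)
  have aI: "a \<in> I" and AI: "A \<subseteq> I" using insert.prems(1) by auto
  let ?N = "N \<inter> defect (T a)"
  let ?Y = "\<Union>r\<in>multi_indices (insert a A).
    multi_power T (insert a A) r ` (N \<inter> defect_space T (insert a A))"
  let ?X = "\<Union>r\<in>multi_indices A. multi_power T A r ` (?N \<inter> defect_space T A)"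
  have N_eq: "N = closed_span (\<Union>n. (T a ^^ n) ` ?N)"
    by (rule reducing_subset_shift_part) (use insert.prems near aI in auto)
  have "?N = closed_span ?X"
  proof (rule insert.IH[OF AI])
    show "closed_csubspace ?N" using insert.prems(2) by (simp add: closed_csubspace_Int)
    show "reduces ?N (T i)" if "i \<in> A" for i
      using that insert.hyps(2) AI aI
      by (intro reduces_Int bounded_op insert.prems(3) reduces_defect) auto
    show "?N \<subseteq> shift_part (T i)" if "i \<in> A" for i using insert.prems(4)[of i] that by auto
  qed
  moreover have "(T a ^^ n) ` ?X \<subseteq> ?Y" for n
  proof safe
    fix r z
    assume r: "r \<in> multi_indices A"
      and z: "z \<in> N" "z \<in> defect (T a)" "z \<in> defect_space T A"
    have "multi_power T A (r(a := n)) = multi_power T A r"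
      by (rule multi_power_cong) (use insert.hyps in auto)
    then have "multi_power T (insert a A) (r(a := n)) z = (T a ^^ n) (multi_power T A r z)"
      by (simp add: multi_power_insert[OF insert.prems(1) insert.hyps(2)])
    moreover have "r(a := n) \<in> multi_indices (insert a A)"
      using r unfolding multi_indices_def by (simp add: fun_upd_in_PiE PiE_fun_upd)
    moreover have "z \<in> N \<inter> defect_space T (insert a A)" using z by (simp add: defect_space_eq)
    ultimately show "(T a ^^ n) (multi_power T A r z) \<in> ?Y" by (metis UN_I imageI)
  qed
  then have "(T a ^^ n) ` closed_span ?X \<subseteq> closed_span ?Y" for n
    by (intro image_closed_span_subset bounded_op_on_funpow bounded_op aI
        closed_csubspace_closed_span order_trans[OF _ closed_span_superset])
  ultimately have "(\<Union>n. (T a ^^ n) ` ?N) \<subseteq> closed_span ?Y" by auto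
  then have "N \<subseteq> closed_span ?Y"
    by (subst N_eq) (intro closed_span_minimal closed_csubspace_closed_span)
  moreover have "closed_span ?Y \<subseteq> N"
  proof (rule closed_span_minimal)
    have "multi_power T (insert a A) r ` N \<subseteq> N" for r
      by (rule multi_power_invariant) (use insert.prems in \<open>auto simp: reduces_def\<close>)
    then show "?Y \<subseteq> N" by blast
  qed (rule insert.prems(2))
  ultimately show ?case by (rule subset_antisym)
qed

lemma wold_part_direct_sum:
  assumes A: "A \<subseteq> I"
  shows "orth_direct_sum (multi_indices A) (\<lambda>r. multi_power T A r ` wandering_part A) (wold_part A)"
proof -
  have "defect_space T A \<subseteq> (\<Inter>i\<in>A. shift_part (T i))"
    unfolding defect_space_eq using defect_subset_shift_part[of _ 0] near A by fastforce
  then have core: "wold_part A \<inter> defect_space T A = wandering_part A"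
    by (auto simp: wold_part_def wandering_part_def)
  have "closed_csubspace (wold_part A)"
    unfolding wold_part_def using A
    by (intro closed_csubspace_Int closed_csubspace_INT)
      (auto simp: shift_part_def intro: reduces_closed[OF reduces_invertible_part[OF near]])
  then have "wold_part A = closed_span (\<Union>r\<in>multi_indices A. multi_power T A r ` wandering_part A)"
    unfolding core[symmetric] using A
    by (intro reducing_eq_monomial_span reduces_wold_part) (auto simp: wold_part_def)
  moreover have "closed_csubspace (multi_power T A r ` wandering_part A)" for r
    using multi_power_bounded[OF A, of r] closed_csubspace_wandering_part[OF A]
    by (intro closed_csubspace_image) auto
  ultimately show ?thesis
    unfolding orth_direct_sum_def closed_span_def
    using orthogonal_monomial_images[OF A] by simp
qed

text \<open>
  For a new index b, N splits into its intersections with the shift part and the invertible part of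
  \<open>T b\<close>; both still reduce the earlier operators. A summand indexed by A then becomes the one
  indexed by \<open>insert b A\<close> or keeps the index A, respectively.
\<close>
lemma reducing_subset_span_parts:
  assumes "B \<subseteq> I" "\<And>i. i \<in> B \<Longrightarrow> reduces N (T i)"
  shows "N \<subseteq> closed_span
    (\<Union>A\<in>Pow B. N \<inter> (\<Inter>i\<in>A. shift_part (T i)) \<inter> (\<Inter>i\<in>B - A. invertible_part (T i)))"
  using finite_subset_I[OF assms(1)] assms
proof (induction B arbitrary: N rule: finite_induct)
  case empty
  then show ?case using closed_span_superset[of N] by simp
next
  case (insert b B)
  define P where "P A = (\<Inter>i\<in>A. shift_part (T i))" for A
  define Q where "Q A = (\<Inter>i\<in>A. invertible_part (T i))" for A
  let ?Y = "\<Union>A\<in>Pow (insert b B). N \<inter> P A \<inter> Q (insert b B - A)"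
  have bI: "b \<in> I" and BI: "B \<subseteq> I" using insert.prems(1) by auto
  have IH: "M \<subseteq> closed_span (\<Union>A\<in>Pow B. M \<inter> P A \<inter> Q (B - A))"
    if "\<And>i. i \<in> B \<Longrightarrow> reduces M (T i)" for M
    unfolding P_def Q_def by (rule insert.IH[OF BI that])
  have "N \<inter> shift_part (T b) \<subseteq>
      closed_span (\<Union>A\<in>Pow B. (N \<inter> shift_part (T b)) \<inter> P A \<inter> Q (B - A))"
    using BI bI by (intro IH reduces_Int bounded_op insert.prems(2) reduces_shift) auto
  also have "\<dots> \<subseteq> closed_span ?Y"
  proof (intro closed_span_mono UN_least)
    fix A assume A: "A \<in> Pow B"
    have "insert b B - insert b A = B - A" using insert.hyps(2) by auto
    then have "(N \<inter> shift_part (T b)) \<inter> P A \<inter> Q (B - A)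
        \<subseteq> N \<inter> P (insert b A) \<inter> Q (insert b B - insert b A)"
      by (auto simp: P_def)
    also have "\<dots> \<subseteq> ?Y" using A by (intro UN_upper) auto
    finally show "(N \<inter> shift_part (T b)) \<inter> P A \<inter> Q (B - A) \<subseteq> ?Y" .
  qed
  finally have shift: "N \<inter> shift_part (T b) \<subseteq> closed_span ?Y" .
  have "N \<inter> invertible_part (T b) \<subseteq>
      closed_span (\<Union>A\<in>Pow B. (N \<inter> invertible_part (T b)) \<inter> P A \<inter> Q (B - A))"
    using BI bI by (intro IH reduces_Int bounded_op insert.prems(2) reduces_invertible) auto
  also have "\<dots> \<subseteq> closed_span ?Y"
  proof (intro closed_span_mono UN_least)
    fix A assume A: "A \<in> Pow B"
    have "(N \<inter> invertible_part (T b)) \<inter> P A \<inter> Q (B - A) \<subseteq> N \<inter> P A \<inter> Q (insert b B - A)"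
      by (auto simp: Q_def)
    also have "\<dots> \<subseteq> ?Y" using A by (intro UN_upper) auto
    finally show "(N \<inter> invertible_part (T b)) \<inter> P A \<inter> Q (B - A) \<subseteq> ?Y" .
  qed
  finally have invertible: "N \<inter> invertible_part (T b) \<subseteq> closed_span ?Y" .
  have "N \<subseteq> closed_span ?Y"
  proof
    fix x assume "x \<in> N"
    then obtain u where "u \<in> N \<inter> invertible_part (T b)" "x - u \<in> N \<inter> shift_part (T b)"
      using wold_decomposition[OF near[OF bI] insert.prems(2)] by blast
    then have "u + (x - u) \<in> closed_span ?Y"
      using shift invertible
      by (intro csubspaceD(2)[OF closed_csubspaceD(1)[OF closed_csubspace_closed_span]]) blast+
    then show "x \<in> closed_span ?Y" by simp
  qed
  then show ?case unfolding P_def Q_def .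
qed

lemma orth_direct_sum_wold_parts: "orth_direct_sum (Pow I) wold_part UNIV"
proof -
  have "orthogonal_sets (wold_part A) (wold_part B)"
    if AB: "A \<in> Pow I" "B \<in> Pow I" "A \<noteq> B" for A B
  proof -
    have perp: "cinner x y = 0" "cinner y x = 0"
      if "x \<in> shift_part (T i)" "y \<in> invertible_part (T i)" for x y i
      using that by (simp_all add: shift_part_def ortho_complement_def cinner_eq_0_commute[of y x])
    consider i where "i \<in> A" "i \<in> I - B" | i where "i \<in> B" "i \<in> I - A"
      using AB by blast
    then show ?thesis
    proof cases
      case 1
      then have "wold_part A \<subseteq> shift_part (T i)" "wold_part B \<subseteq> invertible_part (T i)"
        by (auto simp: wold_part_def)
      then show ?thesis using perp unfolding orthogonal_sets_def by blast
    next
      case 2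
      then have "wold_part B \<subseteq> shift_part (T i)" "wold_part A \<subseteq> invertible_part (T i)"
        by (auto simp: wold_part_def)
      then show ?thesis using perp unfolding orthogonal_sets_def by blast
    qed
  qed
  moreover have "closed_csubspace (wold_part A)" if "A \<in> Pow I" for A
    unfolding wold_part_def using that
    by (intro closed_csubspace_Int closed_csubspace_INT)
      (auto simp: shift_part_def intro: reduces_closed[OF reduces_invertible_part[OF near]])
  moreover have "closed_span (\<Union>A\<in>Pow I. wold_part A) = UNIV"
  proof -
    have "UNIV \<subseteq> closed_span (\<Union>A\<in>Pow I.
        UNIV \<inter> (\<Inter>i\<in>A. shift_part (T i)) \<inter> (\<Inter>i\<in>I - A. invertible_part (T i)))"
      by (rule reducing_subset_span_parts) (simp_all add: reduces_iff_cadjoint bounded_op)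
    then show ?thesis by (simp add: wold_part_def top.extremum_unique)
  qed
  ultimately show ?thesis by (simp add: orth_direct_sum_def closed_span_def)
qed

end

theorem theorem3p4:
  fixes T :: "nat \<Rightarrow> 'a::complex_hilbert \<Rightarrow> 'a" and k m :: nat
  assumes near: "\<And>i. i \<in> {1..k} \<Longrightarrow> near_isometry (T i)"
    and dc: "doubly_commuting k T"
    and m: "2 \<le> m" "m \<le> k"
  shows "\<exists>H :: nat set \<Rightarrow> 'a set.
    (\<forall>A. A \<subseteq> {1..m} \<longrightarrow> (\<forall>i\<in>{1..m}. reduces (H A) (T i))) \<and>
    orth_direct_sum (Pow {1..m}) H UNIV \<and>
    (\<forall>A. A \<subseteq> {1..m} \<and> A \<noteq> {} \<longrightarrow>
      orth_direct_sum (multi_indices A)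
        (\<lambda>r. multi_power T A r `
          (\<Inter>j\<in>multi_indices ({1..m} - A). multi_power T ({1..m} - A) j ` defect_space T A))
        (H A)) \<and>
    H {} = (\<Inter>r\<in>multi_indices {1..m}. range (multi_power T {1..m} r)) \<and>
    (\<forall>A. A \<subseteq> {1..m} \<longrightarrow>
      (\<forall>i\<in>A. shift_on (H A) (T i)) \<and>
      (\<forall>i\<in>{1..m} - A. invertible_on (H A) (T i)))"
proof -
  interpret doubly_commuting_tuple T "{1..m}"
  proof
    have I: "i \<in> {1..k}" if "i \<in> {1..m}" for i using that m by simp
    show "near_isometry (T i)" if "i \<in> {1..m}" for i using I[OF that] by (rule near)
    show "doubly_commute (T i) (T j)" if "i \<in> {1..m}" "j \<in> {1..m}" "i \<noteq> j" for i j
      unfolding doubly_commute_def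
    proof
      note dc' = dc[unfolded doubly_commuting_def]
      show "T i \<circ> T j = T j \<circ> T i"
        by (rule bspec[OF bspec[OF conjunct1[OF dc'] I[OF that(1)]] I[OF that(2)]])
      show "T i \<circ> cadjoint (T j) = cadjoint (T j) \<circ> T i"
        by (rule mp[OF bspec[OF bspec[OF conjunct2[OF dc'] I[OF that(1)]] I[OF that(2)]] that(3)])
    qed
  qed simp
  show ?thesis
  proof (intro exI[of _ wold_part] conjI allI impI ballI)
    show "reduces (wold_part A) (T i)" if "A \<subseteq> {1..m}" "i \<in> {1..m}" for A i
      using that by (rule reduces_wold_part)
    show "orth_direct_sum (Pow {1..m}) wold_part UNIV"
      by (rule orth_direct_sum_wold_parts)
    show "wold_part {} = (\<Inter>r\<in>multi_indices {1..m}. range (multi_power T {1..m} r))"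
      by (rule wold_part_empty_eq)
    show "orth_direct_sum (multi_indices A)
        (\<lambda>r. multi_power T A r `
          (\<Inter>j\<in>multi_indices ({1..m} - A). multi_power T ({1..m} - A) j ` defect_space T A))
        (wold_part A)" if "A \<subseteq> {1..m} \<and> A \<noteq> {}" for A
    proof -
      have A: "A \<subseteq> {1..m}" using that by simp
      show ?thesis
        using wold_part_direct_sum[OF A] unfolding wandering_part_eq[OF A] .
    qed
    show "shift_on (wold_part A) (T i)" if "A \<subseteq> {1..m}" "i \<in> A" for A i
    proof (rule shift_on_reducing)
      have i: "i \<in> {1..m}" using that by blast
      show "near_isometry (T i)" using i by (rule local.near)
      show "reduces (wold_part A) (T i)" using that(1) i by (rule reduces_wold_part)
      show "wold_part A \<subseteq> shift_part (T i)" using that(2) unfolding wold_part_def by blast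
    qed
    show "invertible_on (wold_part A) (T i)" if "A \<subseteq> {1..m}" "i \<in> {1..m} - A" for A i
    proof (rule invertible_on_reducing)
      have i: "i \<in> {1..m}" using that by blast
      show "near_isometry (T i)" using i by (rule local.near)
      show "reduces (wold_part A) (T i)" using that(1) i by (rule reduces_wold_part)
      show "wold_part A \<subseteq> invertible_part (T i)" using that(2) unfolding wold_part_def by blast
    qed
  qed
qed

end
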